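(* Let $(\mathcal X,\mathscr F,\widehat{\mathbb P})$ be a probability space, let $f:\mathcal X\to\mathbb R$ be measurable with $\mathbb E_{\widehat{\mathbb P}}[f]>-\infty$, and let $c:\mathcal X\times\mathcal X\to[0,\infty]$ be measurable with $c(x,x)=0$ for all $x\in\mathcal X$. With the notation of the context, the following hold. (1) For every $\lambda>0$, $$\sup_{\mathbb P\in\bar{\mathcal P}(\mathcal X)}\big\{\mathbb E_{X\sim\mathbb P}[f(X)]-\lambda\,\mathcal K_c(\widehat{\mathbb P},\mathbb P)\big\}=(-\mathcal L)^*(-\lambda)=\sup_{\gamma\in\Gamma_{\widehat{\mathbb P}}}\mathbb E_{(\widehat X,X)\sim\gamma}\big[f(X)-\lambda c(\widehat X,X)\big].$$ (2) For every $\rho>0$, $$\mathcal L(\rho)=\min_{\lambda\ge0}\Big\{\lambda\rho+\sup_{\gamma\in\Gamma_{\widehat{\mathbb P}}}\mathbb E_{(\widehat X,X)\sim\gamma}\big[f(X)-\lambda c(\widehat X,X)\big]\Big\}.$$ (3) For $\lambda>0$ let $\phi_\lambda(\hat x,x):=f(x)-\lambda c(\hat x,x)$. For each $\lambda>0$, the identity $$(-\mathcal L)^*(-\lambda)=\mathbb E_{\widehat X\sim\widehat{\mathbb P}}\Big[\sup_{x\in\mathcal X}\{f(x)-\lambda c(\widehat X,x)\}\Big]$$ holds if and only if $\phi_\lambda$ satisfies the interchangeability principle (IP). (4) The identity $$\mathcal L(\rho)=\min_{\lambda\ge0}\Big\{\lambda\rho+\mathbb E_{\widehat X\sim\widehat{\mathbb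 P}}\Big[\sup_{x\in\mathcal X}\{f(x)-\lambda c(\widehat X,x)\}\Big]\Big\}$$ holds for all $\rho>0$ if and only if $\phi_\lambda$ satisfies (IP) for every $\lambda>0$.
   Context: Conventions: $0\cdot\infty=\infty$. Expectations may take values in $\overline{\mathbb R}=\mathbb R\cup\{\pm\infty\}$; an integral is well defined when the positive or the negative part of the integrand has finite integral. A function on $\mathcal X$ is $\widehat{\mathbb P}$-measurable if it is measurable with respect to the completion $\mathscr F_{\widehat{\mathbb P}}$ of $\mathscr F$ under $\widehat{\mathbb P}$. An identity involving $\mathbb E_{\widehat X\sim\widehat{\mathbb P}}[\sup_x\{\cdot\}]$ is understood to include the $\widehat{\mathbb P}$-measurability of the function $\hat x\mapsto\sup_x\{\cdot\}$ inside the expectation. $\mathcal P(\mathcal X)$ is the set of probability measures on $(\mathcal X,\mathscr F)$; $\Gamma(\widehat{\mathbb P},\mathbb P)$ is the set of probability measures on $(\mathcal X\times\mathcal X,\mathscr F\otimes\mathscr F)$ with first marginal $\widehat{\mathbb P}$ and second marginal $\mathbb P$; $\Gamma_{\widehat{\mathbb P}}$ is the set of probability measures on $(\mathcal X\times\mathcal X,\mathscr F\otimes\mathscr F)$ with first marginal $\widehat{\mathbb P}$. The Kantorovich transport cost is $\mathcal K_c(\widehat{\mathbb P},\mathbb P)=\inf_{\gamma\in\Gamma(\widehat{\mathbb P},\mathbb P)}\mathbb E_{(\widehat X,X)\sim\gamma}[c(\widehat X,X)]$, and $\bar{\mathcal P}(\mathcal X)$ is the set of $\mathbb P\in\mathcal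 P(\mathcal X)$ with $\mathcal K_c(\widehat{\mathbb P},\mathbb P)<\infty$. The robust loss is $\mathcal L(\rho)=\sup_{\mathbb P\in\mathcal P(\mathcal X)}\{\mathbb E_{X\sim\mathbb P}[f(X)]:\mathcal K_c(\widehat{\mathbb P},\mathbb P)\le\rho\}$ for $\rho\ge 0$, with $\mathcal L(\rho)=-\infty$ for $\rho<0$. The Legendre transform of $h:\mathbb R\to\overline{\mathbb R}$ is $h^*(\lambda)=\sup_{\rho\in\mathbb R}\{\lambda\rho-h(\rho)\}$ (with $h^*\equiv+\infty$ if $h$ takes the value $-\infty$); thus $(-\mathcal L)^*(-\lambda)=\sup_{\rho\ge0}\{\mathcal L(\rho)-\lambda\rho\}$. Interchangeability principle (IP): an $(\mathscr F\otimes\mathscr F)$-measurable $\phi:\mathcal X\times\mathcal X\to\mathbb R\cup\{-\infty\}$ satisfies (IP) if $\hat x\mapsto\sup_{x\in\mathcal X}\phi(\hat x,x)$ is $\widehat{\mathbb P}$-measurable and $$\mathbb E_{\widehat X\sim\widehat{\mathbb P}}\Big[\sup_{x\in\mathcal X}\phi(\widehat X,x)\Big]=\sup_{\gamma\in\Gamma_{\widehat{\mathbb P}}}\mathbb E_{(\widehat X,X)\sim\gamma}[\phi(\widehat X,X)].$$ *)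

theory Defs
  imports "HOL-Probability.Probability"
begin

section \<open>Expectations with values in the extended reals\<close>

text \<open>Since \<open>e2ennreal\<close> sends negative numbers to \<open>0\<close>, the integrands below are the positive and
  the negative part of \<open>g\<close>.\<close>

definition expectation_exists :: "'a measure \<Rightarrow> ('a \<Rightarrow> ereal) \<Rightarrow> bool" where
  "expectation_exists M g \<longleftrightarrow> g \<in> borel_measurable M \<and>
     ((\<integral>\<^sup>+ x. e2ennreal (g x) \<partial>M) < \<infinity> \<or> (\<integral>\<^sup>+ x. e2ennreal (- g x) \<partial>M) < \<infinity>)"

text \<open>Only meaningful if \<open>expectation_exists M g\<close>: for \<open>ereal\<close>, \<open>\<infinity> - \<infinity> = \<infinity>\<close>.\<close>

definition ereal_expectation :: "'a measure \<Rightarrow> ('a \<Rightarrow> ereal) \<Rightarrow> ereal" where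
  "ereal_expectation M g =
     enn2ereal (\<integral>\<^sup>+ x. e2ennreal (g x) \<partial>M) - enn2ereal (\<integral>\<^sup>+ x. e2ennreal (- g x) \<partial>M)"

section \<open>Transport plans, transport cost and robust loss\<close>

text \<open>Throughout, the measure \<open>M\<close> is the reference probability space
  \<open>(X, F, Phat)\<close>; in particular \<open>X\<close> is \<open>space M\<close>.\<close>

definition prob_measures :: "'a measure \<Rightarrow> 'a measure set" where
  "prob_measures M = {P. prob_space P \<and> sets P = sets M}"

definition plans_from :: "'a measure \<Rightarrow> ('a \<times> 'a) measure set" where
  "plans_from M = {\<gamma> \<in> prob_measures (M \<Otimes>\<^sub>M M). distr \<gamma> M fst = M}"

definition plans :: "'a measure \<Rightarrow> 'a measure \<Rightarrow> ('a \<times> 'a) measure set" where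
  "plans M P = {\<gamma> \<in> prob_measures (M \<Otimes>\<^sub>M M). distr \<gamma> M fst = M \<and> distr \<gamma> M snd = P}"

definition transport_cost :: "'a measure \<Rightarrow> ('a \<Rightarrow> 'a \<Rightarrow> ennreal) \<Rightarrow> 'a measure \<Rightarrow> ennreal" where
  "transport_cost M c P = (INF \<gamma>\<in>plans M P. \<integral>\<^sup>+ (xh, x). c xh x \<partial>\<gamma>)"

definition finite_cost_measures :: "'a measure \<Rightarrow> ('a \<Rightarrow> 'a \<Rightarrow> ennreal) \<Rightarrow> 'a measure set" where
  "finite_cost_measures M c = {P \<in> prob_measures M. transport_cost M c P < \<infinity>}"

text \<open>Suprema of expectations range over those measures for which the expectation is well
  defined; equivalently, an ill-defined expectation counts as \<open>-\<infinity>\<close> there.\<close>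

definition robust_loss ::
    "'a measure \<Rightarrow> ('a \<Rightarrow> real) \<Rightarrow> ('a \<Rightarrow> 'a \<Rightarrow> ennreal) \<Rightarrow> real \<Rightarrow> ereal" where
  "robust_loss M f c \<rho> =
     (if \<rho> < 0 then -\<infinity>
      else Sup {ereal_expectation P f | P.
             P \<in> prob_measures M \<and> expectation_exists P f \<and> transport_cost M c P \<le> ennreal \<rho>})"

definition plan_sup :: "'a measure \<Rightarrow> ('a \<Rightarrow> 'a \<Rightarrow> ereal) \<Rightarrow> ereal" where
  "plan_sup M \<phi> =
     Sup {ereal_expectation \<gamma> (\<lambda>(xh, x). \<phi> xh x) | \<gamma>.
       \<gamma> \<in> plans_from M \<and> expectation_exists \<gamma> (\<lambda>(xh, x). \<phi> xh x)}"

text \<open>If \<open>h\<close> takes the value \<open>-\<infinity>\<close>, then the supremum is \<open>\<infinity>\<close>, because \<open>ereal r - (-\<infinity>) = \<infinity>\<close>.\<close>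

definition legendre :: "(real \<Rightarrow> ereal) \<Rightarrow> real \<Rightarrow> ereal" where
  "legendre h l = (SUP \<rho>. ereal (l * \<rho>) - h \<rho>)"

text \<open>Scaling of a cost by \<open>l \<ge> 0\<close> with the convention \<open>0 * \<infinity> = \<infinity>\<close>, which differs from the one
  for \<open>ereal\<close>.\<close>

definition scale_cost :: "real \<Rightarrow> ennreal \<Rightarrow> ereal" where
  "scale_cost l t = (if t = \<infinity> then \<infinity> else ereal l * enn2ereal t)"

definition penalized ::
    "('a \<Rightarrow> real) \<Rightarrow> ('a \<Rightarrow> 'a \<Rightarrow> ennreal) \<Rightarrow> real \<Rightarrow> 'a \<Rightarrow> 'a \<Rightarrow> ereal" where
  "penalized f c l xh x = ereal (f x) - scale_cost l (c xh x)"

section \<open>Interchangeability principle\<close>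

definition sup_over :: "'a measure \<Rightarrow> ('a \<Rightarrow> 'a \<Rightarrow> ereal) \<Rightarrow> 'a \<Rightarrow> ereal" where
  "sup_over M \<phi> xh = (SUP x\<in>space M. \<phi> xh x)"

text \<open>\<open>expectation_exists\<close> contains the measurability with respect to the completion.\<close>

definition interchangeable :: "'a measure \<Rightarrow> ('a \<Rightarrow> 'a \<Rightarrow> ereal) \<Rightarrow> bool" where
  "interchangeable M \<phi> \<longleftrightarrow>
     expectation_exists (completion M) (sup_over M \<phi>) \<and>
     ereal_expectation (completion M) (sup_over M \<phi>) = plan_sup M \<phi>"

definition is_minimum :: "ereal \<Rightarrow> ereal set \<Rightarrow> bool" where
  "is_minimum v S \<longleftrightarrow> v \<in> S \<and> (\<forall>u\<in>S. v \<le> u)"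

end

theory Submission
  imports Defs
begin

text \<open>Write \<open>G(\<lambda>)\<close> for the supremum over plans and \<open>H(\<lambda>)\<close> for the expectation of the pointwise
  supremum. Truncating plans shows that \<open>G\<close> is the conjugate of the robust loss \<open>L\<close>. Mixing plans
  shows that \<open>L\<close> is concave, so at every \<open>\<rho> > 0\<close> with \<open>L(\<rho>) < \<infinity>\<close> it has a supergradient, and this
  supergradient attains the dual minimum. Conversely, \<open>H\<close> is convex, nonincreasing, right-continuous and
  bounded below with \<open>G \<le> H\<close>; if \<open>L\<close> is also the conjugate of \<open>H\<close>, then a subgradient of \<open>H\<close>
  gives \<open>H \<le> G\<close> at every \<open>\<lambda> > 0\<close>. At \<open>\<lambda> = 0\<close> both functions are limits from the right.\<close>

section \<open>Expectations\<close>


text \<open>Infinite values shape the proof. A plan can have a well defined expectation of f(X) -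
  \<lambda> c although the expectations of f(X) and of c are both infinite; as it stands it fits no
  finite budget, which is why plans are truncated. Staying put costs nothing and earns f(xh), whose
  expectation exceeds -\<infinity>; this one competitor supplies the lower bound for every limit
  passage. If L(\<rho>) = \<infinity>, every multiplier attains the dual minimum at \<rho>; if
  L(\<rho>) is finite, concavity makes L real on all of [0, \<infinity>), so that real convex
  analysis applies. H may be \<infinity> on an initial interval, and a subgradient is available only
  in the interior of the set where H is finite; the inequality is therefore proved to the right of
  \<lambda> and carried over by right continuity. The convention 0 * \<infinity> = \<infinity> is
  what keeps right continuity true at \<lambda> = 0.\<close>

definition lower_integrable :: "'a measure \<Rightarrow> ('a \<Rightarrow> ereal) \<Rightarrow> bool" where
  "lower_integrable M g \<longleftrightarrow> g \<in> borel_measurable M \<and> (\<integral>\<^sup>+ x. e2ennreal (- g x) \<partial>M) < \<infinity>"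

text \<open>Excluded integrands have expectation -\<infinity> or none, so a supremum of expectations
  does not see them. Those with finite negative part never lead to \<infinity> - \<infinity>, which
  makes their expectation additive.\<close>

lemma lower_integrable_iff:
  "lower_integrable M g \<longleftrightarrow> expectation_exists M g \<and> ereal_expectation M g > -\<infinity>"
proof -
  have "enn2ereal p - enn2ereal n > -\<infinity> \<longleftrightarrow> n < \<infinity>" if "p < \<infinity> \<or> n < \<infinity>" for p n :: ennreal
    using that by (cases p; cases n) auto
  then show ?thesis
    by (auto simp: lower_integrable_def expectation_exists_def ereal_expectation_def)
qed

lemma lower_integrable_measurable: "lower_integrable M g \<Longrightarrow> g \<in> borel_measurable M"
  by (simp add: lower_integrable_def)

lemma ereal_expectation_mono_AE:
  assumes "AE x in M. g x \<le> h x"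
  shows "ereal_expectation M g \<le> ereal_expectation M h"
  unfolding ereal_expectation_def
  using assms
  by (intro ereal_minus_mono; unfold less_eq_ennreal.rep_eq[symmetric];
      intro nn_integral_mono_AE; elim AE_mp) (auto intro!: AE_I2 e2ennreal_mono)

lemma lower_integrable_mono:
  assumes "lower_integrable M g" "h \<in> borel_measurable M" "AE x in M. g x \<le> h x"
  shows "lower_integrable M h"
proof -
  have "(\<integral>\<^sup>+ x. e2ennreal (- h x) \<partial>M) \<le> (\<integral>\<^sup>+ x. e2ennreal (- g x) \<partial>M)"
    using assms(3) by (intro nn_integral_mono_AE; elim AE_mp) (auto intro!: AE_I2 e2ennreal_mono)
  with assms show ?thesis by (auto simp: lower_integrable_def)
qed

lemma lower_integrable_distr_iff:
  assumes "T \<in> measurable M N" "g \<in> borel_measurable N"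
  shows "lower_integrable (distr M N T) g \<longleftrightarrow> lower_integrable M (\<lambda>x. g (T x))"
  using assms by (simp add: lower_integrable_def nn_integral_distr)

lemma ereal_expectation_distr:
  assumes "T \<in> measurable M N" "g \<in> borel_measurable N"
  shows "ereal_expectation (distr M N T) g = ereal_expectation M (\<lambda>x. g (T x))"
  using assms by (simp add: ereal_expectation_def nn_integral_distr)

text \<open>Two decompositions of g are compared without subtraction, which truncates in
  \<open>ennreal\<close>; in this form the identity can be integrated term by term.\<close>

lemma e2ennreal_diff_plus:
  assumes "v < (\<infinity>::ennreal)" "g = enn2ereal u - enn2ereal v"
  shows "e2ennreal g + v = u + e2ennreal (- g)"
proof (cases u)
  case (real a)
  obtain b where b: "b \<ge> 0" "v = ennreal b" using assms(1) by (cases v) auto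
  have g: "g = ereal (a - b)" using assms(2) real b by simp
  show ?thesis
  proof (cases "a \<le> b")
    case True
    then have "ennreal (a - b) = 0" by (simp add: ennreal_neg)
    with True g real b show ?thesis by (simp flip: ennreal_plus)
  next
    case False
    then have "ennreal (b - a) = 0" by (simp add: ennreal_neg)
    with False g real b show ?thesis by (simp flip: ennreal_plus)
  qed
next
  case top
  with assms show ?thesis by (cases v) auto
qed

text \<open>Integrate the subtraction-free identity, then cancel the two finite integrals. This is
  the tool for linearity in the integrand: it suffices to exhibit some u and an integrable
  v.\<close>

lemma
  assumes [measurable]: "g \<in> borel_measurable M" "u \<in> borel_measurable M" "v \<in> borel_measurable M"
    and v: "(\<integral>\<^sup>+ x. v x \<partial>M) < \<infinity>" and g: "AE x in M. g x = enn2ereal (u x) - enn2ereal (v x)"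
  shows lower_integrable_diff: "lower_integrable M g"
    and ereal_expectation_diff:
      "ereal_expectation M g = enn2ereal (\<integral>\<^sup>+ x. u x \<partial>M) - enn2ereal (\<integral>\<^sup>+ x. v x \<partial>M)"
proof -
  have fin: "AE x in M. v x < \<infinity>"
    using nn_integral_noteq_infinite[of v M] v by (auto simp: less_top)
  let ?U = "\<integral>\<^sup>+ x. u x \<partial>M" and ?V = "\<integral>\<^sup>+ x. v x \<partial>M"
  let ?P = "\<integral>\<^sup>+ x. e2ennreal (g x) \<partial>M" and ?N = "\<integral>\<^sup>+ x. e2ennreal (- g x) \<partial>M"
  have ae: "AE x in M. e2ennreal (g x) + v x = u x + e2ennreal (- g x)"
    using g fin by eventually_elim (rule e2ennreal_diff_plus)
  have "?N \<le> ?V"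
  proof (rule nn_integral_mono_AE, use g fin in eventually_elim)
    case (elim x)
    have "- g x \<le> enn2ereal (v x)"
      using elim by (cases "u x"; cases "v x") auto
    then show ?case by (metis e2ennreal_enn2ereal e2ennreal_mono)
  qed
  then have N: "?N < \<infinity>" using v by simp
  then show "lower_integrable M g" by (simp add: lower_integrable_def)
  have "?P + ?V = ?U + ?N"
    using nn_integral_cong_AE[OF ae] by (simp add: nn_integral_add)
  with N v show "ereal_expectation M g = enn2ereal ?U - enn2ereal ?V"
    unfolding ereal_expectation_def
    by (cases ?P; cases ?N; cases ?U; cases ?V) (auto simp flip: ennreal_plus)
qed

lemma ereal_expectation_comb:
  assumes g: "lower_integrable M g" and h: "lower_integrable M h" and t: "0 < s" "0 < t"
  shows "ereal_expectation M (\<lambda>x. ereal s * g x + ereal t * h x) =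
      ereal s * ereal_expectation M g + ereal t * ereal_expectation M h"
proof -
  note [measurable] = g[THEN lower_integrable_measurable] h[THEN lower_integrable_measurable]
  define u where "u x = ennreal s * e2ennreal (g x) + ennreal t * e2ennreal (h x)" for x
  define v where "v x = ennreal s * e2ennreal (- g x) + ennreal t * e2ennreal (- h x)" for x
  have [measurable]: "u \<in> borel_measurable M" "v \<in> borel_measurable M"
    by (simp_all add: u_def[abs_def] v_def[abs_def])
  have U: "(\<integral>\<^sup>+ x. u x \<partial>M) =
      ennreal s * (\<integral>\<^sup>+ x. e2ennreal (g x) \<partial>M) + ennreal t * (\<integral>\<^sup>+ x. e2ennreal (h x) \<partial>M)"
    by (simp add: u_def nn_integral_add nn_integral_cmult)
  have V: "(\<integral>\<^sup>+ x. v x \<partial>M) =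
      ennreal s * (\<integral>\<^sup>+ x. e2ennreal (- g x) \<partial>M) + ennreal t * (\<integral>\<^sup>+ x. e2ennreal (- h x) \<partial>M)"
    by (simp add: v_def nn_integral_add nn_integral_cmult)
  have fin: "(\<integral>\<^sup>+ x. v x \<partial>M) < \<infinity>"
    using g h by (simp add: V lower_integrable_def ennreal_mult_less_top)
  \<comment> \<open>Finiteness of v excludes the value -\<infinity> for g and h, so the sum on the
    left is unambiguous.\<close>
  have eq: "ereal s * g x + ereal t * h x = enn2ereal (u x) - enn2ereal (v x)" if "v x < \<infinity>" for x
  proof -
    have "- g x < \<infinity>" "- h x < \<infinity>"
      using that t by (auto simp: v_def ennreal_mult_less_top less_top ennreal_mult_eq_top_iff)
    then show ?thesis
      using t by (cases "g x"; cases "h x")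
        (auto simp: u_def v_def ennreal_neg plus_ennreal.rep_eq times_ennreal.rep_eq ennreal_mult_top
          max_def ennreal.rep_eq top_ennreal.rep_eq)
  qed
  have "AE x in M. v x \<noteq> \<infinity>"
    using fin by (intro nn_integral_noteq_infinite) auto
  then have ae: "AE x in M. ereal s * g x + ereal t * h x = enn2ereal (u x) - enn2ereal (v x)"
    by eventually_elim (auto intro!: eq simp: less_top)
  have "ereal_expectation M (\<lambda>x. ereal s * g x + ereal t * h x) =
      enn2ereal (\<integral>\<^sup>+ x. u x \<partial>M) - enn2ereal (\<integral>\<^sup>+ x. v x \<partial>M)"
    by (rule ereal_expectation_diff[OF _ _ _ fin ae]) measurable
  also have "\<dots> = ereal s * ereal_expectation M g + ereal t * ereal_expectation M h"
    using g h t unfolding U V ereal_expectation_def lower_integrable_def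
    by (cases "\<integral>\<^sup>+ x. e2ennreal (g x) \<partial>M"; cases "\<integral>\<^sup>+ x. e2ennreal (- g x) \<partial>M";
        cases "\<integral>\<^sup>+ x. e2ennreal (h x) \<partial>M"; cases "\<integral>\<^sup>+ x. e2ennreal (- h x) \<partial>M")
      (auto simp: plus_ennreal.rep_eq times_ennreal.rep_eq max_def top_ennreal.rep_eq ennreal.rep_eq algebra_simps)
  finally show "ereal_expectation M (\<lambda>x. ereal s * g x + ereal t * h x) =
      ereal s * ereal_expectation M g + ereal t * ereal_expectation M h" .
qed

lemma enn2ereal_SUP: "enn2ereal (SUP n. u n) = (SUP n. enn2ereal (u n))" for u :: "nat \<Rightarrow> ennreal"
proof (rule antisym)
  let ?S = "SUP n. enn2ereal (u n)"
  have "(SUP n. u n) \<le> e2ennreal ?S"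
    by (intro SUP_least) (metis e2ennreal_enn2ereal e2ennreal_mono SUP_upper UNIV_I)
  moreover have "0 \<le> ?S"
    by (rule SUP_upper2[of 0]) auto
  ultimately show "enn2ereal (SUP n. u n) \<le> ?S"
    by (simp add: less_eq_ennreal.rep_eq enn2ereal_e2ennreal)
  show "?S \<le> enn2ereal (SUP n. u n)"
    by (intro SUP_least) (auto simp flip: less_eq_ennreal.rep_eq intro: SUP_upper)
qed

text \<open>Adding the negative part v of the common minorant makes all integrands nonnegative, so
  monotone convergence in \<open>ennreal\<close> applies; v is real valued with finite integral and
  can be subtracted again.\<close>

lemma ereal_expectation_monotone_convergence:
  fixes g :: "nat \<Rightarrow> 'a \<Rightarrow> ereal" and h :: "'a \<Rightarrow> real"
  assumes [measurable]: "\<And>n. g n \<in> borel_measurable M"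
    and inc: "\<And>x. x \<in> space M \<Longrightarrow> incseq (\<lambda>n. g n x)"
    and h: "lower_integrable M h" and le: "\<And>n x. x \<in> space M \<Longrightarrow> h x \<le> g n x"
  shows "ereal_expectation M (\<lambda>x. SUP n. g n x) = (SUP n. ereal_expectation M (g n))"
proof -
  have [measurable]: "h \<in> borel_measurable M"
    using h[THEN lower_integrable_measurable] by simp
  define v where "v x = ennreal (- h x)" for x
  have [measurable]: "v \<in> borel_measurable M"
    by (simp add: v_def[abs_def])
  have V: "(\<integral>\<^sup>+ x. v x \<partial>M) < \<infinity>"
    using h by (simp add: v_def lower_integrable_def)
  define u where "u n x = e2ennreal (g n x + enn2ereal (v x))" for n x
  have [measurable]: "u n \<in> borel_measurable M" for n
    unfolding u_def by measurable
  have nonneg: "0 \<le> g n x + enn2ereal (v x)" if "x \<in> space M" for n x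
    using le[OF that, of n] by (cases "g n x") (auto simp: v_def ennreal.rep_eq max_def)
  have eq: "g n x = enn2ereal (u n x) - enn2ereal (v x)" if "x \<in> space M" for n x
  proof -
    have "enn2ereal (u n x) = g n x + enn2ereal (v x)"
      unfolding u_def by (rule enn2ereal_e2ennreal[OF nonneg[OF that]])
    then show ?thesis by (cases "g n x") (auto simp: v_def ennreal.rep_eq max_def)
  qed
  have incu: "incseq (\<lambda>n. u n x)" if "x \<in> space M" for x
    using inc[OF that] by (auto simp: u_def incseq_def intro!: e2ennreal_mono add_right_mono)
  have E: "ereal_expectation M (g n) = enn2ereal (\<integral>\<^sup>+ x. u n x \<partial>M) - enn2ereal (\<integral>\<^sup>+ x. v x \<partial>M)" for n
    by (rule ereal_expectation_diff) (use V eq in auto)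
  have sup: "(SUP n. g n x) = enn2ereal (SUP n. u n x) - enn2ereal (v x)" if "x \<in> space M" for x
  proof -
    have "(SUP n. g n x) = (SUP n. enn2ereal (u n x) - enn2ereal (v x))"
      using eq[OF that] by simp
    also have "\<dots> = (SUP n. enn2ereal (u n x)) - enn2ereal (v x)"
      by (rule SUP_ereal_minus_left) (auto simp: v_def)
    also have "(SUP n. enn2ereal (u n x)) = enn2ereal (SUP n. u n x)"
      by (simp add: enn2ereal_SUP)
    finally show ?thesis .
  qed
  have "ereal_expectation M (\<lambda>x. SUP n. g n x) =
      enn2ereal (\<integral>\<^sup>+ x. (SUP n. u n x) \<partial>M) - enn2ereal (\<integral>\<^sup>+ x. v x \<partial>M)"
    by (rule ereal_expectation_diff) (use V sup in auto)
  also have "(\<integral>\<^sup>+ x. (SUP n. u n x) \<partial>M) = (SUP n. \<integral>\<^sup>+ x. u n x \<partial>M)"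
    by (rule nn_integral_monotone_convergence_SUP_AE) (use incu in \<open>auto simp: incseq_Suc_iff\<close>)
  also have "enn2ereal (SUP n. \<integral>\<^sup>+ x. u n x \<partial>M) - enn2ereal (\<integral>\<^sup>+ x. v x \<partial>M) =
      (SUP n. enn2ereal (\<integral>\<^sup>+ x. u n x \<partial>M) - enn2ereal (\<integral>\<^sup>+ x. v x \<partial>M))"
    using V by (subst SUP_ereal_minus_left) (auto simp: enn2ereal_SUP)
  finally show ?thesis by (simp add: E)
qed

section \<open>Expectations under the completed reference measure\<close>

lemma lower_integrable_completion_iff:
  assumes "g \<in> borel_measurable M"
  shows "lower_integrable (completion M) g \<longleftrightarrow> lower_integrable M g"
  using assms by (simp add: lower_integrable_def nn_integral_completion measurable_completion)

lemma ereal_expectation_completion: "ereal_expectation (completion M) g = ereal_expectation M g"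
  by (simp add: ereal_expectation_def nn_integral_completion)

text \<open>Since p is measurable for the completion only, its composition with T need not be
  measurable. Replace p by an N-measurable version: the exceptional set pulls back to a null set
  because T carries K to N, and \<open>nn_integral_cong_AE\<close> asks for no
  measurability.\<close>

lemma nn_integral_comp_eq_completion:
  assumes T: "T \<in> measurable K N" "distr K N T = N" and p: "p \<in> borel_measurable (completion N)"
  shows "(\<integral>\<^sup>+ x. p (T x) \<partial>K) = (\<integral>\<^sup>+ x. p x \<partial>(completion N))"
proof -
  obtain p' where p': "p' \<in> borel_measurable N" and eq: "AE x in N. p x = p' x"
    using completion_ex_borel_measurable[OF p] by auto
  have "AE x in K. p (T x) = p' (T x)"
    using AE_distrD[OF T(1), of "\<lambda>x. p x = p' x"] eq unfolding T(2) by blast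
  then have "(\<integral>\<^sup>+ x. p (T x) \<partial>K) = (\<integral>\<^sup>+ x. p' (T x) \<partial>K)"
    by (rule nn_integral_cong_AE)
  also have "\<dots> = (\<integral>\<^sup>+ x. p' x \<partial>N)"
    using nn_integral_distr[OF T(1), of p'] p' by (simp add: T(2))
  also have "\<dots> = (\<integral>\<^sup>+ x. p x \<partial>N)"
    using eq by (intro nn_integral_cong_AE) auto
  finally show ?thesis by (simp add: nn_integral_completion)
qed

lemma ereal_expectation_comp_eq_completion:
  assumes T: "T \<in> measurable K N" "distr K N T = N" and [measurable]: "g \<in> borel_measurable (completion N)"
  shows "ereal_expectation K (\<lambda>x. g (T x)) = ereal_expectation (completion N) g"
  unfolding ereal_expectation_def
  by (simp add: nn_integral_comp_eq_completion[OF T, of "\<lambda>x. e2ennreal (g x)"]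
      nn_integral_comp_eq_completion[OF T, of "\<lambda>x. e2ennreal (- g x)"])

section \<open>Mixtures and costs\<close>


text \<open>The measure (1 - t) P + t Q, encoded as a coin toss followed by a draw, so that total
  mass, integrals and pushforwards come from the laws of the Giry monad.\<close>

definition mixture :: "real \<Rightarrow> 'a measure \<Rightarrow> 'a measure \<Rightarrow> 'a measure" where
  "mixture t P Q = measure_pmf (bernoulli_pmf t) \<bind> (\<lambda>b. if b then Q else P)"

context
  fixes t :: real and P Q S :: "'a measure"
  assumes t: "0 < t" "t < 1" and P: "P \<in> prob_measures S" and Q: "Q \<in> prob_measures S"
begin

lemma mixture_kernel:
  "(\<lambda>b. if b then Q else P) \<in> measurable (measure_pmf (bernoulli_pmf t)) (subprob_algebra S)"
  using P Q by (auto simp: prob_measures_def space_subprob_algebra prob_space_imp_subprob_space)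

lemma mixture_in_prob_measures: "mixture t P Q \<in> prob_measures S"
proof -
  have "prob_space (mixture t P Q)"
    unfolding mixture_def using P Q
    by (intro prob_space.prob_space_bind[OF _ _ mixture_kernel])
      (auto simp: prob_measures_def measure_pmf.prob_space_axioms)
  moreover have "sets (mixture t P Q) = sets S"
    unfolding mixture_def using P Q by (intro sets_bind) (auto simp: prob_measures_def)
  ultimately show ?thesis by (simp add: prob_measures_def)
qed

lemma nn_integral_mixture:
  assumes "g \<in> borel_measurable S"
  shows "(\<integral>\<^sup>+ x. g x \<partial>mixture t P Q) =
    ennreal (1 - t) * (\<integral>\<^sup>+ x. g x \<partial>P) + ennreal t * (\<integral>\<^sup>+ x. g x \<partial>Q)"
  unfolding mixture_def nn_integral_bind[OF assms mixture_kernel]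
  using t by (simp add: ac_simps)

lemma distr_mixture:
  assumes "T \<in> measurable S R"
  shows "distr (mixture t P Q) R T = mixture t (distr P R T) (distr Q R T)"
  unfolding mixture_def
  by (subst distr_bind[OF mixture_kernel _ assms]) (auto intro!: arg_cong[where f="bind _"])

lemma
  assumes g: "lower_integrable P g" and h: "lower_integrable Q g"
  shows lower_integrable_mixture: "lower_integrable (mixture t P Q) g"
    and ereal_expectation_mixture: "ereal_expectation (mixture t P Q) g =
      ereal (1 - t) * ereal_expectation P g + ereal t * ereal_expectation Q g"
proof -
  have [measurable]: "g \<in> borel_measurable S"
    using lower_integrable_measurable[OF g] P by (simp add: prob_measures_def cong: measurable_cong_sets)
  have "g \<in> borel_measurable (mixture t P Q)"
    using mixture_in_prob_measures by (simp add: prob_measures_def cong: measurable_cong_sets)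
  then show "lower_integrable (mixture t P Q) g"
    using g h by (simp add: lower_integrable_def nn_integral_mixture ennreal_mult_less_top)
  show "ereal_expectation (mixture t P Q) g =
      ereal (1 - t) * ereal_expectation P g + ereal t * ereal_expectation Q g"
    using t g h unfolding ereal_expectation_def lower_integrable_def
    by (simp add: nn_integral_mixture)
      (cases "\<integral>\<^sup>+ x. e2ennreal (g x) \<partial>P"; cases "\<integral>\<^sup>+ x. e2ennreal (- g x) \<partial>P";
        cases "\<integral>\<^sup>+ x. e2ennreal (g x) \<partial>Q"; cases "\<integral>\<^sup>+ x. e2ennreal (- g x) \<partial>Q";
        auto simp: plus_ennreal.rep_eq times_ennreal.rep_eq max_def top_ennreal.rep_eq ennreal.rep_eq algebra_simps)
qed

end

lemma mixture_same: "prob_space P \<Longrightarrow> mixture t P P = P"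
  unfolding mixture_def
  by (simp add: bind_const' measure_pmf.prob_space_axioms prob_space_imp_subprob_space)

section \<open>Scaled costs and penalized payoffs\<close>

lemma measurable_scale_cost [measurable]: "scale_cost l \<in> borel_measurable borel"
  unfolding scale_cost_def[abs_def] by measurable

lemma scale_cost_zero [simp]: "scale_cost l 0 = 0"
  by (simp add: scale_cost_def zero_ennreal.rep_eq)

lemma scale_cost_finite: "0 \<le> l \<Longrightarrow> t < \<infinity> \<Longrightarrow> scale_cost l t = enn2ereal (ennreal l * t)"
  by (auto simp: scale_cost_def times_ennreal.rep_eq ennreal.rep_eq)

lemma scale_cost_nonneg: "0 \<le> l \<Longrightarrow> 0 \<le> scale_cost l t"
  by (simp add: scale_cost_def)

lemma scale_cost_ennreal: "0 \<le> r \<Longrightarrow> scale_cost l (ennreal r) = ereal (l * r)"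
  by (simp add: scale_cost_def ennreal.rep_eq)

lemma scale_cost_mono: "0 \<le> l \<Longrightarrow> l \<le> k \<Longrightarrow> scale_cost l t \<le> scale_cost k t"
  by (cases t) (auto simp: scale_cost_def ennreal.rep_eq intro: mult_right_mono)

lemma penalized_antimono:
  "0 \<le> l \<Longrightarrow> l \<le> k \<Longrightarrow> penalized f c k xh x \<le> penalized f c l xh x"
  unfolding penalized_def by (intro ereal_minus_mono order_refl scale_cost_mono)

lemma penalized_le: "0 \<le> l \<Longrightarrow> penalized f c l xh x \<le> f x"
  unfolding penalized_def using scale_cost_nonneg[of l "c xh x"]
  by (cases "scale_cost l (c xh x)") auto

lemma convex_on_subgradient:
  fixes h :: "real \<Rightarrow> real"
  assumes "convex_on I h" "x \<in> interior I"
  obtains g where "\<And>y. y \<in> I \<Longrightarrow> h x + g * (y - x) \<le> h y"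
  using convex_le_Inf_differential[OF assms] by blast

section \<open>Duality\<close>

locale transport_problem =
  fixes M :: "'a measure" and f :: "'a \<Rightarrow> real" and c :: "'a \<Rightarrow> 'a \<Rightarrow> ennreal"
  assumes prob: "prob_space M"
    and lower_f: "lower_integrable M f"
    and cost_measurable: "(\<lambda>(xh, x). c xh x) \<in> borel_measurable (M \<Otimes>\<^sub>M M)"
    and cost_refl: "\<And>x. x \<in> space M \<Longrightarrow> c x x = 0"
begin

lemma f_measurable [measurable]: "f \<in> borel_measurable M"
  using lower_f[THEN lower_integrable_measurable] by simp

lemma c_measurable [measurable]:
  assumes "g \<in> measurable N M" "h \<in> measurable N M"
  shows "(\<lambda>w. c (g w) (h w)) \<in> borel_measurable N"
  using measurable_compose[OF measurable_Pair[OF assms] cost_measurable] by simp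

lemma penalized_measurable [measurable]:
  assumes [measurable]: "g \<in> measurable N M" "h \<in> measurable N M"
  shows "(\<lambda>w. penalized f c l (g w) (h w)) \<in> borel_measurable N"
  unfolding penalized_def by measurable

lemma penalized_refl: "x \<in> space M \<Longrightarrow> penalized f c l x x = f x"
  by (simp add: penalized_def cost_refl)

section \<open>Transport plans and their costs\<close>

lemma plans_fromD:
  assumes "\<gamma> \<in> plans_from M"
  shows "prob_space \<gamma>" "sets \<gamma> = sets (M \<Otimes>\<^sub>M M)" "distr \<gamma> M fst = M"
    "fst \<in> measurable \<gamma> M" "snd \<in> measurable \<gamma> M"
    "distr \<gamma> M snd \<in> prob_measures M" "\<gamma> \<in> plans M (distr \<gamma> M snd)"
    "lower_integrable \<gamma> (\<lambda>w. f (fst w))"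
proof -
  show *: "prob_space \<gamma>" "sets \<gamma> = sets (M \<Otimes>\<^sub>M M)" "distr \<gamma> M fst = M"
    using assms by (auto simp: plans_from_def prob_measures_def)
  show **: "fst \<in> measurable \<gamma> M" "snd \<in> measurable \<gamma> M"
    by (simp_all add: *(2) cong: measurable_cong_sets)
  show "distr \<gamma> M snd \<in> prob_measures M" "\<gamma> \<in> plans M (distr \<gamma> M snd)"
    using assms * ** by (auto simp: plans_from_def plans_def prob_measures_def prob_space.prob_space_distr)
  show "lower_integrable \<gamma> (\<lambda>w. f (fst w))"
    using lower_f lower_integrable_distr_iff[OF **(1), of "\<lambda>x. ereal (f x)"] by (simp add: *(3))
qed

lemma plansD:
  assumes "\<gamma> \<in> plans M P"
  shows "\<gamma> \<in> plans_from M" "distr \<gamma> M snd = P"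
  using assms by (auto simp: plans_def plans_from_def)

lemma transport_cost_eq:
  "transport_cost M c P = (INF \<gamma>\<in>plans M P. \<integral>\<^sup>+ w. c (fst w) (snd w) \<partial>\<gamma>)"
  by (simp add: transport_cost_def case_prod_beta')

lemma transport_cost_le: "\<gamma> \<in> plans M P \<Longrightarrow> transport_cost M c P \<le> (\<integral>\<^sup>+ w. c (fst w) (snd w) \<partial>\<gamma>)"
  unfolding transport_cost_eq by (rule INF_lower)

lemma transport_cost_lessE:
  assumes "transport_cost M c P < a"
  obtains \<gamma> where "\<gamma> \<in> plans M P" "(\<integral>\<^sup>+ w. c (fst w) (snd w) \<partial>\<gamma>) < a"
  using assms by (auto simp: transport_cost_eq INF_less_iff)

text \<open>A finite expected cost makes c finite almost everywhere, and there
  \<open>scale_cost\<close> is ordinary multiplication, even for l = 0. The payoff then splits into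
  u, the positive part of f at the target, and v, its negative part plus the scaled cost.\<close>

lemma
  assumes \<gamma>: "\<gamma> \<in> plans_from M" and l: "0 \<le> l"
    and low: "lower_integrable \<gamma> (\<lambda>w. f (snd w))"
    and C: "(\<integral>\<^sup>+ w. c (fst w) (snd w) \<partial>\<gamma>) < \<infinity>"
  shows lower_integrable_penalized: "lower_integrable \<gamma> (\<lambda>w. penalized f c l (fst w) (snd w))"
    and expectation_penalized: "ereal_expectation \<gamma> (\<lambda>w. penalized f c l (fst w) (snd w)) =
      ereal_expectation \<gamma> (\<lambda>w. f (snd w)) - ereal (l * enn2real (\<integral>\<^sup>+ w. c (fst w) (snd w) \<partial>\<gamma>))"
proof -
  note [measurable] = plans_fromD(4,5)[OF \<gamma>]
  let ?C = "\<integral>\<^sup>+ w. c (fst w) (snd w) \<partial>\<gamma>"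
  define u where "u w = ennreal (f (snd w))" for w :: "'a \<times> 'a"
  define v where "v w = ennreal (- f (snd w)) + ennreal l * c (fst w) (snd w)" for w
  have [measurable]: "u \<in> borel_measurable \<gamma>" "v \<in> borel_measurable \<gamma>"
    by (simp_all add: u_def[abs_def] v_def[abs_def])
  have V: "(\<integral>\<^sup>+ w. v w \<partial>\<gamma>) = (\<integral>\<^sup>+ w. ennreal (- f (snd w)) \<partial>\<gamma>) + ennreal l * ?C"
    by (simp add: v_def nn_integral_add nn_integral_cmult)
  have fin: "(\<integral>\<^sup>+ w. v w \<partial>\<gamma>) < \<infinity>"
    using low C by (simp add: V lower_integrable_def ennreal_mult_less_top)
  have eq: "penalized f c l (fst w) (snd w) = enn2ereal (u w) - enn2ereal (v w)"
    if "c (fst w) (snd w) < \<infinity>" for w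
    using that l by (cases "c (fst w) (snd w)")
      (auto simp: u_def v_def penalized_def scale_cost_finite plus_ennreal.rep_eq times_ennreal.rep_eq
        ennreal.rep_eq max_def)
  have "AE w in \<gamma>. c (fst w) (snd w) \<noteq> \<infinity>"
    using C by (intro nn_integral_noteq_infinite) auto
  then have ae: "AE w in \<gamma>. penalized f c l (fst w) (snd w) = enn2ereal (u w) - enn2ereal (v w)"
    by eventually_elim (auto intro!: eq simp: less_top)
  show "lower_integrable \<gamma> (\<lambda>w. penalized f c l (fst w) (snd w))"
    by (rule lower_integrable_diff[OF _ _ _ fin ae]) measurable
  have "ereal_expectation \<gamma> (\<lambda>w. penalized f c l (fst w) (snd w)) =
      enn2ereal (\<integral>\<^sup>+ w. u w \<partial>\<gamma>) - enn2ereal (\<integral>\<^sup>+ w. v w \<partial>\<gamma>)"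
    by (rule ereal_expectation_diff[OF _ _ _ fin ae]) measurable
  also have "\<dots> = ereal_expectation \<gamma> (\<lambda>w. f (snd w)) - ereal (l * enn2real ?C)"
    using low C l unfolding V ereal_expectation_def lower_integrable_def u_def
    by (cases "\<integral>\<^sup>+ w. ennreal (f (snd w)) \<partial>\<gamma>"; cases "\<integral>\<^sup>+ w. ennreal (- f (snd w)) \<partial>\<gamma>"; cases ?C)
      (auto simp: plus_ennreal.rep_eq times_ennreal.rep_eq max_def top_ennreal.rep_eq ennreal.rep_eq)
  finally show "ereal_expectation \<gamma> (\<lambda>w. penalized f c l (fst w) (snd w)) =
      ereal_expectation \<gamma> (\<lambda>w. f (snd w)) - ereal (l * enn2real ?C)" .
qed

section \<open>Weak duality and conjugacy\<close>

lemma plan_sup_upper: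
  assumes "\<gamma> \<in> plans_from M" "lower_integrable \<gamma> (\<lambda>w. \<phi> (fst w) (snd w))"
  shows "ereal_expectation \<gamma> (\<lambda>w. \<phi> (fst w) (snd w)) \<le> plan_sup M \<phi>"
  unfolding plan_sup_def using assms
  by (intro Sup_upper) (auto simp: case_prod_beta' lower_integrable_iff)

lemma robust_loss_upper:
  assumes "0 \<le> \<rho>" "P \<in> prob_measures M" "lower_integrable P f" "transport_cost M c P \<le> ennreal \<rho>"
  shows "ereal_expectation P f \<le> robust_loss M f c \<rho>"
  unfolding robust_loss_def using assms
  by (auto intro!: Sup_upper simp: lower_integrable_iff)

lemma robust_loss_least:
  assumes "0 \<le> \<rho>"
    and "\<And>P. \<lbrakk>P \<in> prob_measures M; lower_integrable P f; transport_cost M c P \<le> ennreal \<rho>\<rbrakk>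
      \<Longrightarrow> ereal_expectation P f \<le> B"
  shows "robust_loss M f c \<rho> \<le> B"
proof -
  have "ereal_expectation P f \<le> B"
    if "P \<in> prob_measures M" "expectation_exists P f" "transport_cost M c P \<le> ennreal \<rho>" for P
    using assms(2)[OF that(1) _ that(3)] that(2) by (cases "ereal_expectation P f") (auto simp: lower_integrable_iff)
  then show ?thesis
    using assms(1) by (auto simp: robust_loss_def intro!: Sup_least)
qed

lemma robust_loss_mono: "0 \<le> \<rho> \<Longrightarrow> \<rho> \<le> \<rho>' \<Longrightarrow> robust_loss M f c \<rho> \<le> robust_loss M f c \<rho>'"
  by (intro robust_loss_least robust_loss_upper) (auto elim: order_trans intro: ennreal_leI)

text \<open>The diagonal plan costs nothing, so \<open>M\<close> itself is feasible for every
  budget.\<close>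

lemma robust_loss_ge:
  assumes "0 \<le> \<rho>" shows "ereal_expectation M f \<le> robust_loss M f c \<rho>"
proof (rule robust_loss_upper[OF assms _ lower_f])
  show M: "M \<in> prob_measures M" using prob by (simp add: prob_measures_def)
  define \<gamma> where "\<gamma> = distr M (M \<Otimes>\<^sub>M M) (\<lambda>x. (x, x))"
  have "\<gamma> \<in> plans M M"
    using prob by (simp add: \<gamma>_def plans_def prob_measures_def prob_space.prob_space_distr distr_distr comp_def distr_id)
  then have "transport_cost M c M \<le> (\<integral>\<^sup>+ w. c (fst w) (snd w) \<partial>\<gamma>)" by (rule transport_cost_le)
  also have "\<dots> = (\<integral>\<^sup>+ x. c x x \<partial>M)" by (simp add: \<gamma>_def nn_integral_distr)
  also have "\<dots> = (\<integral>\<^sup>+ x. 0 \<partial>M)" by (intro nn_integral_cong) (simp add: cost_refl)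
  finally show "transport_cost M c M \<le> ennreal \<rho>" by simp
qed

lemma robust_loss_le_plan_sup:
  assumes l: "0 \<le> l" and \<rho>: "0 \<le> \<rho>"
  shows "robust_loss M f c \<rho> \<le> ereal (l * \<rho>) + plan_sup M (penalized f c l)"
proof (rule robust_loss_least[OF \<rho>])
  fix P assume P: "P \<in> prob_measures M" "lower_integrable P f" "transport_cost M c P \<le> ennreal \<rho>"
  let ?G = "plan_sup M (penalized f c l)"
  show "ereal_expectation P f \<le> ereal (l * \<rho>) + ?G"
  proof (rule ereal_le_epsilon2)
    fix e :: real assume e: "0 < e"
    \<comment> \<open>The infimum over plans need not be attained, so the plan may overspend the
      budget by d; the 1 in the denominator covers l = 0.\<close>
    define d where "d = e / (l + 1)"
    have d: "0 < d" "l * d \<le> e" using e l by (auto simp: d_def field_simps)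
    have "transport_cost M c P < ennreal (\<rho> + d)"
      using P(3) by (rule order.strict_trans1) (use d \<rho> in \<open>auto simp: ennreal_less_iff\<close>)
    then obtain \<gamma> where \<gamma>: "\<gamma> \<in> plans M P" and C: "(\<integral>\<^sup>+ w. c (fst w) (snd w) \<partial>\<gamma>) < ennreal (\<rho> + d)"
      by (rule transport_cost_lessE)
    let ?C = "enn2real (\<integral>\<^sup>+ w. c (fst w) (snd w) \<partial>\<gamma>)"
    note \<gamma>' = plansD[OF \<gamma>]
    note [measurable] = plans_fromD(4,5)[OF \<gamma>'(1)]
    have low: "lower_integrable \<gamma> (\<lambda>w. f (snd w))"
      using P(2) lower_integrable_distr_iff[of snd \<gamma> M "\<lambda>x. ereal (f x)"] by (simp add: \<gamma>'(2))
    have E: "ereal_expectation P f = ereal_expectation \<gamma> (\<lambda>w. f (snd w))"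
      using ereal_expectation_distr[of snd \<gamma> M "\<lambda>x. ereal (f x)"] by (simp add: \<gamma>'(2))
    have fin: "(\<integral>\<^sup>+ w. c (fst w) (snd w) \<partial>\<gamma>) < \<infinity>"
      using C by (rule order.strict_trans) simp
    have "?C \<le> \<rho> + d"
      using C d \<rho> by (intro enn2real_leI) auto
    then have "l * ?C \<le> l * \<rho> + e"
      using d l mult_left_mono[of ?C "\<rho> + d" l] by (simp add: algebra_simps)
    moreover have "ereal_expectation P f - ereal (l * ?C) \<le> ?G"
      using plan_sup_upper[OF \<gamma>'(1) lower_integrable_penalized[OF \<gamma>'(1) l low fin]]
      by (simp add: expectation_penalized[OF \<gamma>'(1) l low fin] E)
    ultimately show "ereal_expectation P f \<le> ereal (l * \<rho>) + ?G + ereal e"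
      by (cases "ereal_expectation P f"; cases ?G) auto
  qed
qed

text \<open>A plan is replaced by the plan that moves mass only where the move pays off and costs at most
  \<open>n\<close>: its cost is finite and its objective increases with \<open>n\<close> to at least the original one.\<close>

lemma plan_sup_le:
  assumes l: "0 \<le> l" and B: "\<And>\<rho>. 0 \<le> \<rho> \<Longrightarrow> robust_loss M f c \<rho> \<le> ereal (l * \<rho>) + B"
  shows "plan_sup M (penalized f c l) \<le> B"
proof -
  have "ereal_expectation \<gamma> (\<lambda>w. penalized f c l (fst w) (snd w)) \<le> B" if \<gamma>: "\<gamma> \<in> plans_from M" for \<gamma>
  proof -
    note [measurable] = plans_fromD(4,5)[OF \<gamma>]
    interpret \<gamma>: prob_space \<gamma> by (rule plans_fromD(1)[OF \<gamma>])
    have space: "fst w \<in> space M" if "w \<in> space \<gamma>" for w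
      using measurable_space[OF plans_fromD(4)[OF \<gamma>] that] .
    define \<phi> where "\<phi> w = penalized f c l (fst w) (snd w)" for w
    have [measurable]: "\<phi> \<in> borel_measurable (M \<Otimes>\<^sub>M M)" "\<phi> \<in> borel_measurable \<gamma>"
      by (simp_all add: \<phi>_def[abs_def])
    define A where "A n w \<longleftrightarrow> ereal (f (fst w)) \<le> \<phi> w \<and> c (fst w) (snd w) \<le> of_nat n" for n :: nat and w
    have [measurable]: "Measurable.pred \<gamma> (A n)" for n
      by (simp add: A_def[abs_def])
    define T where "T n w = (fst w, if A n w then snd w else fst w)" for n w
    have T[measurable]: "T n \<in> measurable \<gamma> (M \<Otimes>\<^sub>M M)" for n
      by (simp add: T_def[abs_def])
    have bound: "ereal_expectation \<gamma> (\<lambda>w. \<phi> (T n w)) \<le> B" for n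
    proof -
      define \<gamma>' where "\<gamma>' = distr \<gamma> (M \<Otimes>\<^sub>M M) (T n)"
      have \<gamma>': "\<gamma>' \<in> plans_from M"
        using plans_fromD(3)[OF \<gamma>]
        by (simp add: \<gamma>'_def plans_from_def prob_measures_def \<gamma>.prob_space_distr distr_distr comp_def T_def)
      note [measurable] = plans_fromD(4,5)[OF \<gamma>']
      let ?C = "\<integral>\<^sup>+ w. c (fst w) (snd w) \<partial>\<gamma>'"
      have "?C = (\<integral>\<^sup>+ w. c (fst (T n w)) (snd (T n w)) \<partial>\<gamma>)"
        by (simp add: \<gamma>'_def nn_integral_distr)
      also have "\<dots> \<le> (\<integral>\<^sup>+ w. of_nat n \<partial>\<gamma>)"
        by (intro nn_integral_mono) (auto simp: T_def A_def cost_refl space)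
      finally have C: "?C < \<infinity>"
        by (rule order.strict_trans1) (simp add: \<gamma>.emeasure_space_1 of_nat_less_top)
      have low: "lower_integrable \<gamma>' (\<lambda>w. f (snd w))"
        unfolding \<gamma>'_def
      proof (subst lower_integrable_distr_iff[OF T], simp, rule lower_integrable_mono)
        show "lower_integrable \<gamma> (\<lambda>w. f (fst w))" by (rule plans_fromD(8)[OF \<gamma>])
        \<comment> \<open>A move that pays off after the penalty also pays off before it, so the
          truncated plan earns at least as much as staying put.\<close>
        have "f (fst w) \<le> f (snd w)" if "A n w" for w
          using that order_trans[OF _ penalized_le[OF l, of f c "fst w" "snd w"]]
          by (force simp: A_def \<phi>_def)
        then show "AE w in \<gamma>. ereal (f (fst w)) \<le> ereal (f (snd (T n w)))"
          by (auto simp: T_def)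
      qed measurable
      let ?P = "distr \<gamma>' M snd"
      have lowP: "lower_integrable ?P f"
        using low by (subst lower_integrable_distr_iff) auto
      \<comment> \<open>The budget is the cost of the truncated plan itself, which bounds the
        transport cost of its second marginal.\<close>
      have "ereal_expectation ?P f \<le> robust_loss M f c (enn2real ?C)"
        using plans_fromD(6,7)[OF \<gamma>'] lowP C by (intro robust_loss_upper) (auto intro: transport_cost_le)
      also have "\<dots> \<le> ereal (l * enn2real ?C) + B" by (rule B) simp
      also have "ereal_expectation ?P f = ereal_expectation \<gamma>' (\<lambda>w. f (snd w))"
        by (subst ereal_expectation_distr) auto
      finally have "ereal_expectation \<gamma>' (\<lambda>w. f (snd w)) - ereal (l * enn2real ?C) \<le> B"
        by (cases "ereal_expectation \<gamma>' (\<lambda>w. f (snd w))"; cases B) auto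
      then have "ereal_expectation \<gamma>' \<phi> \<le> B"
        by (simp add: expectation_penalized[OF \<gamma>' l low C] \<phi>_def[abs_def])
      then show ?thesis unfolding \<gamma>'_def by (subst (asm) ereal_expectation_distr) auto
    qed
    have stay: "\<phi> (T n w) = (if A n w then \<phi> w else f (fst w))" if "w \<in> space \<gamma>" for n w
      using space[OF that] by (simp add: T_def \<phi>_def penalized_refl)
    \<comment> \<open>Unprofitable moves are undone, so the pointwise limit is the larger of
      \<open>\<phi> w\<close> and the payoff of staying put.\<close>
    have "ereal_expectation \<gamma> \<phi> \<le> ereal_expectation \<gamma> (\<lambda>w. SUP n. \<phi> (T n w))"
    proof (intro ereal_expectation_mono_AE AE_I2)
      fix w assume w: "w \<in> space \<gamma>"
      show "\<phi> w \<le> (SUP n. \<phi> (T n w))"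
      proof (cases "ereal (f (fst w)) \<le> \<phi> w")
        case True
        \<comment> \<open>A profitable move has finite cost, also for l = 0, since
          \<open>scale_cost\<close> keeps an infinite cost infinite.\<close>
        then have "c (fst w) (snd w) \<noteq> \<infinity>"
          by (auto simp: \<phi>_def penalized_def scale_cost_def)
        then obtain n :: nat where "c (fst w) (snd w) \<le> of_nat n"
          by (metis ennreal_Ex_less_of_nat infinity_ennreal_def less_imp_le less_top)
        with True have "A n w" by (simp add: A_def)
        then show ?thesis by (intro SUP_upper2[of n]) (auto simp: stay w)
      next
        case False
        then show ?thesis by (intro SUP_upper2[of 0]) (auto simp: stay w A_def)
      qed
    qed
    also have "\<dots> = (SUP n. ereal_expectation \<gamma> (\<lambda>w. \<phi> (T n w)))"
    proof (rule ereal_expectation_monotone_convergence)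
      show "lower_integrable \<gamma> (\<lambda>w. f (fst w))" by (rule plans_fromD(8)[OF \<gamma>])
      show "incseq (\<lambda>n. \<phi> (T n w))" if "w \<in> space \<gamma>" for w
      proof (rule incseq_SucI)
        fix n
        have "A (Suc n) w" if "A n w"
          using that order_trans[of "c (fst w) (snd w)" "of_nat n" "of_nat (Suc n)"]
          by (auto simp: A_def)
        then show "\<phi> (T n w) \<le> \<phi> (T (Suc n) w)"
          using that by (auto simp: stay A_def)
      qed
      show "ereal (f (fst w)) \<le> \<phi> (T n w)" if "w \<in> space \<gamma>" for n w
        using that by (auto simp: stay A_def)
    qed measurable
    also have "\<dots> \<le> B" by (intro SUP_least bound)
    finally show ?thesis by (simp add: \<phi>_def[abs_def])
  qed
  then show ?thesis
    by (auto simp: plan_sup_def case_prod_beta' intro!: Sup_least)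
qed

lemma legendre_robust_loss:
  assumes l: "0 \<le> l"
  shows "legendre (\<lambda>\<rho>. - robust_loss M f c \<rho>) (- l) = plan_sup M (penalized f c l)"
proof (rule antisym)
  let ?G = "plan_sup M (penalized f c l)"
  show "legendre (\<lambda>\<rho>. - robust_loss M f c \<rho>) (- l) \<le> ?G"
    unfolding legendre_def
  proof (rule SUP_least)
    fix \<rho> :: real
    show "ereal (- l * \<rho>) - - robust_loss M f c \<rho> \<le> ?G"
    proof (cases "\<rho> < 0")
      case True
      \<comment> \<open>A negative budget has loss -\<infinity>, so its term in the transform is
        -\<infinity>.\<close>
      then show ?thesis by (simp add: robust_loss_def)
    next
      case False
      with robust_loss_le_plan_sup[OF l, of \<rho>] show ?thesis
        by (cases "robust_loss M f c \<rho>"; cases ?G) auto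
    qed
  qed
  show "?G \<le> legendre (\<lambda>\<rho>. - robust_loss M f c \<rho>) (- l)"
  proof (rule plan_sup_le[OF l])
    fix \<rho> :: real
    have "ereal (- l * \<rho>) - - robust_loss M f c \<rho> \<le> legendre (\<lambda>\<rho>. - robust_loss M f c \<rho>) (- l)"
      unfolding legendre_def by (rule SUP_upper) simp
    then show "robust_loss M f c \<rho> \<le> ereal (l * \<rho>) + legendre (\<lambda>\<rho>. - robust_loss M f c \<rho>) (- l)"
      by (cases "robust_loss M f c \<rho>"; cases "legendre (\<lambda>\<rho>. - robust_loss M f c \<rho>) (- l)") auto
  qed
qed

text \<open>Both sides are the least B with L(\<rho>) \<le> l \<rho> + B for all \<rho> \<ge> 0: a
  measure of transport cost k is feasible for the budget k, and a measure feasible for \<rho> is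
  penalized by at most l \<rho>.\<close>

lemma penalty_sup_eq_plan_sup:
  assumes l: "0 \<le> l"
  shows "Sup {ereal_expectation P f - scale_cost l (transport_cost M c P) | P.
      P \<in> finite_cost_measures M c \<and> expectation_exists P f} = plan_sup M (penalized f c l)"
    (is "?A = ?G")
proof (rule antisym)
  show "?A \<le> ?G"
  proof (rule Sup_least, clarify)
    fix P assume P: "P \<in> finite_cost_measures M c" "expectation_exists P f"
    then obtain k where k: "0 \<le> k" "transport_cost M c P = ennreal k"
      by (cases "transport_cost M c P") (auto simp: finite_cost_measures_def)
    show "ereal_expectation P f - scale_cost l (transport_cost M c P) \<le> ?G"
    proof (cases "ereal_expectation P f = -\<infinity>")
      case True
      then show ?thesis by (simp add: k scale_cost_ennreal)
    next
      case False
      with P(2) have "lower_integrable P f" by (simp add: lower_integrable_iff)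
      then have "ereal_expectation P f \<le> robust_loss M f c k"
        using P(1) k by (intro robust_loss_upper) (auto simp: finite_cost_measures_def)
      also have "\<dots> \<le> ereal (l * k) + ?G" by (rule robust_loss_le_plan_sup[OF l k(1)])
      finally show ?thesis using k
        by (cases "ereal_expectation P f"; cases ?G) (auto simp: scale_cost_ennreal)
    qed
  qed
  show "?G \<le> ?A"
  proof (rule plan_sup_le[OF l], rule robust_loss_least)
    fix \<rho> P assume \<rho>: "0 \<le> \<rho>"
      and P: "P \<in> prob_measures M" "lower_integrable P f" "transport_cost M c P \<le> ennreal \<rho>"
    have "transport_cost M c P < \<infinity>"
      using P(3) by (rule order.strict_trans1) simp
    with P(3) \<rho> obtain k where k: "0 \<le> k" "transport_cost M c P = ennreal k" "k \<le> \<rho>"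
      by (cases "transport_cost M c P") auto
    have "ereal_expectation P f - scale_cost l (transport_cost M c P) \<le> ?A"
      using P \<open>transport_cost M c P < \<infinity>\<close>
      by (intro Sup_upper) (auto simp: finite_cost_measures_def lower_integrable_iff)
    moreover have "l * k \<le> l * \<rho>" using k l by (intro mult_left_mono)
    ultimately show "ereal_expectation P f \<le> ereal (l * \<rho>) + ?A"
      using k by (cases "ereal_expectation P f"; cases ?A) (auto simp: scale_cost_ennreal)
  qed
qed

lemma plan_sup_antimono:
  assumes "0 \<le> l" "l \<le> k"
  shows "plan_sup M (penalized f c k) \<le> plan_sup M (penalized f c l)"
proof (rule plan_sup_le)
  fix \<rho> :: real assume \<rho>: "0 \<le> \<rho>"
  have "robust_loss M f c \<rho> \<le> ereal (l * \<rho>) + plan_sup M (penalized f c l)"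
    by (rule robust_loss_le_plan_sup[OF assms(1) \<rho>])
  also have "\<dots> \<le> ereal (k * \<rho>) + plan_sup M (penalized f c l)"
    using assms \<rho> by (intro add_right_mono) (simp add: mult_right_mono)
  finally show "robust_loss M f c \<rho> \<le> ereal (k * \<rho>) + plan_sup M (penalized f c l)" .
qed (use assms in simp)

section \<open>Concavity of the robust loss and attainment of the dual minimum\<close>

text \<open>Near-optimal plans mixed with the same weights form a plan for the mixture, because both
  have first marginal \<open>M\<close>; the cost is linear in the plan, and the common slack e
  averages to e.\<close>

lemma transport_cost_mixture:
  assumes t: "0 < t" "t < 1"
    and P: "P \<in> prob_measures M" "transport_cost M c P \<le> ennreal a" "0 \<le> a"
    and Q: "Q \<in> prob_measures M" "transport_cost M c Q \<le> ennreal b" "0 \<le> b"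
  shows "transport_cost M c (mixture t P Q) \<le> ennreal ((1 - t) * a + t * b)"
proof (rule ennreal_le_epsilon)
  fix e :: real assume e: "0 < e"
  have "transport_cost M c P < ennreal (a + e)" "transport_cost M c Q < ennreal (b + e)"
    using P Q e by (auto intro: order.strict_trans1 simp: ennreal_less_iff)
  then obtain \<gamma> \<delta> where \<gamma>: "\<gamma> \<in> plans M P" and \<delta>: "\<delta> \<in> plans M Q"
    and C: "(\<integral>\<^sup>+ w. c (fst w) (snd w) \<partial>\<gamma>) < ennreal (a + e)"
      "(\<integral>\<^sup>+ w. c (fst w) (snd w) \<partial>\<delta>) < ennreal (b + e)"
    by (auto elim!: transport_cost_lessE)
  have \<gamma>': "\<gamma> \<in> prob_measures (M \<Otimes>\<^sub>M M)" and \<delta>': "\<delta> \<in> prob_measures (M \<Otimes>\<^sub>M M)"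
    using \<gamma> \<delta> by (auto simp: plans_def)
  have "mixture t \<gamma> \<delta> \<in> plans M (mixture t P Q)"
    using \<gamma> \<delta> mixture_in_prob_measures[OF t \<gamma>' \<delta>'] prob
    by (simp add: plans_def distr_mixture[OF t \<gamma>' \<delta>'] mixture_same)
  then have "transport_cost M c (mixture t P Q) \<le> (\<integral>\<^sup>+ w. c (fst w) (snd w) \<partial>mixture t \<gamma> \<delta>)"
    by (rule transport_cost_le)
  also have "\<dots> = ennreal (1 - t) * (\<integral>\<^sup>+ w. c (fst w) (snd w) \<partial>\<gamma>) +
      ennreal t * (\<integral>\<^sup>+ w. c (fst w) (snd w) \<partial>\<delta>)"
    by (rule nn_integral_mixture[OF t \<gamma>' \<delta>']) measurable
  also have "\<dots> \<le> ennreal (1 - t) * ennreal (a + e) + ennreal t * ennreal (b + e)"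
    using C by (intro add_mono mult_left_mono) auto
  also have "\<dots> = ennreal ((1 - t) * (a + e) + t * (b + e))"
    using t P(3) Q(3) e by (simp flip: ennreal_mult ennreal_plus)
  also have "(1 - t) * (a + e) + t * (b + e) = ((1 - t) * a + t * b) + e"
    by (simp add: algebra_simps)
  also have "ennreal \<dots> = ennreal ((1 - t) * a + t * b) + ennreal e"
    using t P(3) Q(3) e by (intro ennreal_plus) auto
  finally show "transport_cost M c (mixture t P Q) \<le> ennreal ((1 - t) * a + t * b) + ennreal e" .
qed

text \<open>Phrased with strict real minorants because the loss can be \<infinity> and its supremum
  need not be attained.\<close>

lemma robust_loss_concave:
  assumes t: "0 < t" "t < 1" and \<rho>: "0 \<le> \<rho>" "0 \<le> \<sigma>"
    and a: "ereal a < robust_loss M f c \<rho>" and b: "ereal b < robust_loss M f c \<sigma>"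
  shows "ereal ((1 - t) * a + t * b) \<le> robust_loss M f c ((1 - t) * \<rho> + t * \<sigma>)"
proof -
  have *: "\<exists>P. P \<in> prob_measures M \<and> lower_integrable P f \<and> transport_cost M c P \<le> ennreal r \<and>
      ereal x \<le> ereal_expectation P f"
    if "ereal x < robust_loss M f c r" "0 \<le> r" for x r
    using that robust_loss_least[of r "ereal x"] by (meson not_le nle_le)
  obtain P where P: "P \<in> prob_measures M" "lower_integrable P f" "transport_cost M c P \<le> ennreal \<rho>"
    "ereal a \<le> ereal_expectation P f"
    using *[OF a \<rho>(1)] by blast
  obtain Q where Q: "Q \<in> prob_measures M" "lower_integrable Q f" "transport_cost M c Q \<le> ennreal \<sigma>"
    "ereal b \<le> ereal_expectation Q f"
    using *[OF b \<rho>(2)] by blast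
  have "ereal ((1 - t) * a + t * b) = ereal (1 - t) * ereal a + ereal t * ereal b" by simp
  also have "\<dots> \<le> ereal (1 - t) * ereal_expectation P f + ereal t * ereal_expectation Q f"
    using P(4) Q(4) t by (intro add_mono ereal_mult_left_mono) auto
  also have "\<dots> = ereal_expectation (mixture t P Q) f"
    by (rule ereal_expectation_mixture[symmetric, OF t P(1) Q(1) P(2) Q(2)])
  also have "\<dots> \<le> robust_loss M f c ((1 - t) * \<rho> + t * \<sigma>)"
    using t \<rho> P Q
    by (intro robust_loss_upper mixture_in_prob_measures lower_integrable_mixture transport_cost_mixture) auto
  finally show ?thesis .
qed

lemma f_lower_bound: obtains m where "ereal m \<le> ereal_expectation M f"
proof -
  have "ereal_expectation M f \<noteq> -\<infinity>"
    using lower_f by (auto simp: lower_integrable_iff)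
  then show thesis using that by (cases "ereal_expectation M f") auto
qed

text \<open>If the loss were infinite at a larger budget, concavity on the segment from 0, where the
  loss exceeds -\<infinity>, would make it infinite at \<rho>.\<close>

lemma robust_loss_finite:
  assumes \<rho>: "0 < \<rho>" "robust_loss M f c \<rho> < \<infinity>" and \<sigma>: "0 \<le> \<sigma>"
  shows "robust_loss M f c \<sigma> = ereal (real_of_ereal (robust_loss M f c \<sigma>))"
proof -
  obtain m where m: "ereal m \<le> ereal_expectation M f" by (rule f_lower_bound)
  have ge: "ereal m \<le> robust_loss M f c r" if "0 \<le> r" for r
    using m robust_loss_ge[OF that] by (rule order_trans)
  have "robust_loss M f c \<sigma> < \<infinity>"
  proof (cases "\<sigma> \<le> \<rho>")
    case True
    then show ?thesis using robust_loss_mono[OF \<sigma>] \<rho>(2) by (meson order.strict_trans1)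
  next
    case False
    define t where "t = \<rho> / \<sigma>"
    have t: "0 < t" "t < 1" and eq: "(1 - t) * 0 + t * \<sigma> = \<rho>"
      using False \<rho> by (auto simp: t_def)
    obtain r where r: "robust_loss M f c \<rho> = ereal r"
      using \<rho> ge[of \<rho>] by (cases "robust_loss M f c \<rho>") auto
    show ?thesis
    proof (rule ccontr)
      assume "\<not> ?thesis"
      then have inf: "robust_loss M f c \<sigma> = \<infinity>" by simp
      \<comment> \<open>Solves (1 - t) (m - 1) + t b = r + t, a value above the loss r at \<rho>.
        The minorant at budget 0 has to be strict, hence m - 1.\<close>
      define b where "b = (r - (1 - t) * (m - 1)) / t + 1"
      have "ereal (m - 1) < robust_loss M f c 0"
        by (rule order.strict_trans2[OF _ ge]) simp_all
      then have "ereal ((1 - t) * (m - 1) + t * b) \<le> robust_loss M f c \<rho>"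
        using robust_loss_concave[OF t, of 0 \<sigma> "m - 1" b] \<sigma> inf eq by simp
      then have "(1 - t) * (m - 1) + t * b \<le> r" by (simp add: r)
      moreover have "(1 - t) * (m - 1) + t * b = r + t"
        using t by (simp add: b_def field_simps)
      ultimately show False using t by simp
    qed
  qed
  with ge[OF \<sigma>] show ?thesis by (cases "robust_loss M f c \<sigma>") auto
qed

lemma robust_loss_is_minimum:
  assumes \<rho>: "0 < \<rho>"
  shows "is_minimum (robust_loss M f c \<rho>)
    {ereal (l * \<rho>) + plan_sup M (penalized f c l) | l. 0 \<le> l}"
proof -
  have "\<exists>l\<ge>0. ereal (l * \<rho>) + plan_sup M (penalized f c l) \<le> robust_loss M f c \<rho>"
  proof (cases "robust_loss M f c \<rho> < \<infinity>")
    case False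
    then show ?thesis by auto
  next
    case True
    define h where "h r = - real_of_ereal (robust_loss M f c r)" for r
    have L: "robust_loss M f c r = ereal (- h r)" if "0 \<le> r" for r
      using robust_loss_finite[OF \<rho> True that] by (simp add: h_def)
    have "convex_on {0..} h"
    proof (rule convex_onI)
      fix t x y :: real assume t: "0 < t" "t < 1" and xy: "x \<in> {0..}" "y \<in> {0..}"
      let ?z = "(1 - t) * x + t * y"
      have z: "0 \<le> ?z" using t xy by simp
      \<comment> \<open>\<open>robust_loss_concave\<close> takes strict minorants, so both values
        are lowered by e.\<close>
      have "(1 - t) * (- h x) + t * (- h y) \<le> - h ?z + e" if "0 < e" for e
        using robust_loss_concave[OF t, of x y "- h x - e" "- h y - e"] xy z that
        by (simp add: L algebra_simps)
      then have "(1 - t) * (- h x) + t * (- h y) \<le> - h ?z"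
        by (rule field_le_epsilon)
      then show "h ((1 - t) *\<^sub>R x + t *\<^sub>R y) \<le> (1 - t) * h x + t * h y"
        by simp
    qed (rule convex_real_interval)
    \<comment> \<open>Since \<rho> > 0 is interior to the half-line, h has a subgradient g there.
      The multiplier is -g, nonnegative because the loss does not decrease in the budget.\<close>
    then obtain g where g: "\<And>y. 0 \<le> y \<Longrightarrow> h \<rho> + g * (y - \<rho>) \<le> h y"
      using convex_on_subgradient[of "{0..}" h \<rho>] \<rho> by auto
    have "h (\<rho> + 1) \<le> h \<rho>"
      using robust_loss_mono[of \<rho> "\<rho> + 1"] \<rho> by (simp add: L)
    with g[of "\<rho> + 1"] \<rho> have g0: "0 \<le> - g" by simp
    \<comment> \<open>The supporting line at \<rho> bounds the loss at every budget, and
      \<open>plan_sup_le\<close> turns its intercept into a bound on the conjugate.\<close>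
    have "plan_sup M (penalized f c (- g)) \<le> ereal (- h \<rho> + g * \<rho>)"
    proof (rule plan_sup_le[OF g0])
      fix r :: real assume "0 \<le> r"
      then show "robust_loss M f c r \<le> ereal (- g * r) + ereal (- h \<rho> + g * \<rho>)"
        using g[of r] by (simp add: L algebra_simps)
    qed
    then have "ereal (- g * \<rho>) + plan_sup M (penalized f c (- g)) \<le> robust_loss M f c \<rho>"
      using \<rho> by (cases "plan_sup M (penalized f c (- g))") (auto simp: L)
    with g0 show ?thesis by blast
  qed
  then obtain l where l: "0 \<le> l" "ereal (l * \<rho>) + plan_sup M (penalized f c l) \<le> robust_loss M f c \<rho>"
    by blast
  moreover from l have "robust_loss M f c \<rho> = ereal (l * \<rho>) + plan_sup M (penalized f c l)"
    using robust_loss_le_plan_sup[OF l(1), of \<rho>] \<rho> by (intro antisym) auto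
  ultimately show ?thesis
    using robust_loss_le_plan_sup[of _ \<rho>] \<rho> unfolding is_minimum_def by fastforce
qed

section \<open>The pointwise supremum and its expectation\<close>

abbreviation sup_pen :: "real \<Rightarrow> 'a \<Rightarrow> ereal" where
  "sup_pen l \<equiv> sup_over M (penalized f c l)"

abbreviation sup_expectation :: "real \<Rightarrow> ereal" where
  "sup_expectation l \<equiv> ereal_expectation (completion M) (sup_pen l)"

lemma sup_pen_upper: "y \<in> space M \<Longrightarrow> penalized f c l x y \<le> sup_pen l x"
  unfolding sup_over_def by (rule SUP_upper)

lemma sup_pen_ge: "x \<in> space M \<Longrightarrow> f x \<le> sup_pen l x"
  using sup_pen_upper[of x l x] by (simp add: penalized_refl)

lemma lower_f_completion: "lower_integrable (completion M) f"
  using lower_f by (simp add: lower_integrable_completion_iff)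

lemma lower_integrable_sup_pen:
  "sup_pen l \<in> borel_measurable (completion M) \<Longrightarrow> lower_integrable (completion M) (sup_pen l)"
  by (rule lower_integrable_mono[OF lower_f_completion]) (auto intro!: AE_I2 sup_pen_ge)

text \<open>Staying put bounds the supremum below by f, so only measurability is at stake.\<close>

lemma expectation_exists_sup_pen_iff:
  "expectation_exists (completion M) (sup_pen l) \<longleftrightarrow> sup_pen l \<in> borel_measurable (completion M)"
  using lower_integrable_sup_pen[of l] by (auto simp: lower_integrable_iff expectation_exists_def)

lemma sup_expectation_ge: "ereal_expectation M f \<le> sup_expectation l"
proof -
  have "ereal_expectation (completion M) f \<le> sup_expectation l"
    by (intro ereal_expectation_mono_AE AE_I2) (simp add: sup_pen_ge)
  then show ?thesis by (simp only: ereal_expectation_completion)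
qed

lemma sup_pen_antimono: "0 \<le> l \<Longrightarrow> l \<le> k \<Longrightarrow> sup_pen k x \<le> sup_pen l x"
  unfolding sup_over_def by (intro SUP_mono' penalized_antimono)

lemma sup_expectation_antimono: "0 \<le> l \<Longrightarrow> l \<le> k \<Longrightarrow> sup_expectation k \<le> sup_expectation l"
  by (intro ereal_expectation_mono_AE AE_I2 sup_pen_antimono)

text \<open>At finite cost this is continuity of an affine function of the multiplier; at infinite
  cost every term is -\<infinity>, including the limit at l = 0 by the convention in
  \<open>scale_cost\<close>.\<close>

lemma SUP_penalized:
  assumes "0 \<le> l"
  shows "(SUP n. penalized f c (l + 1 / Suc n) x y) = penalized f c l x y"
proof (cases "c x y")
  case (real r)
  have eq: "penalized f c k x y = ereal (f y - k * r)" for k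
    using real by (simp add: penalized_def scale_cost_ennreal)
  have "incseq (\<lambda>n. penalized f c (l + 1 / Suc n) x y)"
    using assms by (intro incseq_SucI penalized_antimono) (auto simp: field_simps)
  then have "(\<lambda>n. penalized f c (l + 1 / Suc n) x y) \<longlonglongrightarrow> (SUP n. penalized f c (l + 1 / Suc n) x y)"
    by (rule LIMSEQ_SUP)
  moreover have "(\<lambda>n. penalized f c (l + 1 / Suc n) x y) \<longlonglongrightarrow> penalized f c l x y"
  proof -
    have "(\<lambda>n. 1 / real (Suc n)) \<longlonglongrightarrow> 0"
      using LIMSEQ_inverse_real_of_nat by (simp only: inverse_eq_divide)
    then have "(\<lambda>n. ereal (f y - (l + 1 / real (Suc n)) * r)) \<longlonglongrightarrow> ereal (f y - (l + 0) * r)"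
      by (intro tendsto_intros)
    then show ?thesis by (simp only: eq add_0_right)
  qed
  ultimately show ?thesis by (rule LIMSEQ_unique)
next
  case top
  then show ?thesis by (simp add: penalized_def scale_cost_def)
qed

text \<open>Approaching l from the right makes the limit a supremum, and suprema commute; from the
  left it would be an infimum.\<close>

lemma SUP_sup_pen:
  assumes "0 \<le> l"
  shows "(SUP n. sup_pen (l + 1 / Suc n) x) = sup_pen l x"
  unfolding sup_over_def by (subst SUP_commute) (simp only: SUP_penalized[OF assms])

lemma sup_pen_measurable_limit:
  assumes "0 \<le> l" and "\<And>n. sup_pen (l + 1 / Suc n) \<in> borel_measurable (completion M)"
  shows "sup_pen l \<in> borel_measurable (completion M)"
proof -
  have "(\<lambda>x. SUP n. sup_pen (l + 1 / Suc n) x) \<in> borel_measurable (completion M)"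
    using assms(2) by (intro borel_measurable_SUP) auto
  then show ?thesis by (simp only: SUP_sup_pen[OF assms(1)])
qed

lemma SUP_sup_expectation:
  assumes "0 \<le> l" and "\<And>n. sup_pen (l + 1 / Suc n) \<in> borel_measurable (completion M)"
  shows "sup_expectation l = (SUP n. sup_expectation (l + 1 / Suc n))"
proof -
  have "sup_expectation l = ereal_expectation (completion M) (\<lambda>x. SUP n. sup_pen (l + 1 / Suc n) x)"
    by (simp only: SUP_sup_pen[OF assms(1)])
  also have "\<dots> = (SUP n. sup_expectation (l + 1 / Suc n))"
  proof (rule ereal_expectation_monotone_convergence[OF assms(2) _ lower_f_completion])
    show "incseq (\<lambda>n. sup_pen (l + 1 / Suc n) x)" for x
      using assms by (intro incseq_SucI sup_pen_antimono) (auto simp: field_simps)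
  qed (auto intro: sup_pen_ge)
  finally show ?thesis .
qed

text \<open>The supremum depends on the first coordinate only, whose law is \<open>M\<close> under
  every plan.\<close>

lemma plan_sup_le_sup_expectation:
  assumes meas: "sup_pen l \<in> borel_measurable (completion M)"
  shows "plan_sup M (penalized f c l) \<le> sup_expectation l"
proof -
  have "ereal_expectation \<gamma> (\<lambda>w. penalized f c l (fst w) (snd w)) \<le> sup_expectation l"
    if \<gamma>: "\<gamma> \<in> plans_from M" for \<gamma>
  proof -
    have "ereal_expectation \<gamma> (\<lambda>w. penalized f c l (fst w) (snd w)) \<le>
        ereal_expectation \<gamma> (\<lambda>w. sup_pen l (fst w))"
      using measurable_space[OF plans_fromD(5)[OF \<gamma>]]
      by (intro ereal_expectation_mono_AE AE_I2 sup_pen_upper)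
    also have "\<dots> = sup_expectation l"
      by (rule ereal_expectation_comp_eq_completion[OF plans_fromD(4,3)[OF \<gamma>] meas])
    finally show ?thesis .
  qed
  then show ?thesis
    by (auto simp: plan_sup_def case_prod_beta' intro!: Sup_least)
qed

text \<open>For a fixed pair the payoff is affine in the multiplier or constantly -\<infinity>;
  suprema and expectations preserve the resulting convexity.\<close>

lemma sup_expectation_convex:
  assumes t: "0 < t" "t < 1" and a: "0 \<le> a" and b: "0 \<le> b"
    and meas: "sup_pen a \<in> borel_measurable (completion M)" "sup_pen b \<in> borel_measurable (completion M)"
  shows "sup_expectation ((1 - t) * a + t * b) \<le>
    ereal (1 - t) * sup_expectation a + ereal t * sup_expectation b"
proof -
  have "sup_pen ((1 - t) * a + t * b) x \<le> ereal (1 - t) * sup_pen a x + ereal t * sup_pen b x" for x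
    unfolding sup_over_def[of M "penalized f c ((1 - t) * a + t * b)"]
  proof (rule SUP_least)
    fix y assume y: "y \<in> space M"
    have "penalized f c ((1 - t) * a + t * b) x y \<le>
        ereal (1 - t) * penalized f c a x y + ereal t * penalized f c b x y"
    proof (cases "c x y")
      case (real r)
      then have "penalized f c k x y = ereal (f y - k * r)" for k
        by (simp add: penalized_def scale_cost_ennreal)
      then show ?thesis by (simp add: algebra_simps)
    qed (simp add: penalized_def scale_cost_def)
    also have "\<dots> \<le> ereal (1 - t) * sup_pen a x + ereal t * sup_pen b x"
      using t by (intro add_mono ereal_mult_left_mono sup_pen_upper y) auto
    finally show "penalized f c ((1 - t) * a + t * b) x y \<le>
      ereal (1 - t) * sup_pen a x + ereal t * sup_pen b x" .
  qed
  then have "sup_expectation ((1 - t) * a + t * b) \<le>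
      ereal_expectation (completion M) (\<lambda>x. ereal (1 - t) * sup_pen a x + ereal t * sup_pen b x)"
    by (intro ereal_expectation_mono_AE AE_I2)
  also have "\<dots> = ereal (1 - t) * sup_expectation a + ereal t * sup_expectation b"
    using t meas by (intro ereal_expectation_comb lower_integrable_sup_pen) auto
  finally show ?thesis .
qed

section \<open>From the dual formula back to interchangeability\<close>

text \<open>The dual formula and weak duality give k \<rho> + H(k) = L(\<rho>) \<le> x \<rho> + G(x)
  with no control over k, so the left side must be bounded below for all k at once. If g is a
  subgradient of H at x and \<rho> is close to -g, the supporting line gives the bound H(x) - g x,
  hence H(x) \<le> G(x) up to a small error.\<close>

lemma sup_expectation_le_plan_sup:
  assumes meas: "\<And>l. 0 \<le> l \<Longrightarrow> sup_pen l \<in> borel_measurable (completion M)"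
    and attained: "\<And>\<rho>. 0 < \<rho> \<Longrightarrow> \<exists>l\<ge>0. robust_loss M f c \<rho> = ereal (l * \<rho>) + sup_expectation l"
    and l: "0 < l"
  shows "sup_expectation l \<le> plan_sup M (penalized f c l)"
proof -
  let ?H = sup_expectation and ?G = "\<lambda>l. plan_sup M (penalized f c l)"
  obtain m where "ereal m \<le> ereal_expectation M f" by (rule f_lower_bound)
  then have m: "ereal m \<le> ?H k" for k using sup_expectation_ge[of k] by (rule order_trans)
  have "?H x \<le> ?G l" if x: "l < x" for x
  proof -
    \<comment> \<open>The midpoint serves both cases: if H(u) is finite, x is interior to the domain
      of H; if not, u exceeds l by a fixed amount.\<close>
    define u where "u = (l + x) / 2"
    have u: "0 < u" "l < u" "u < x" using l x by (auto simp: u_def)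
    show ?thesis
    proof (cases "?H u < \<infinity>")
      case False
      \<comment> \<open>H is infinite on [0, u], so a multiplier attaining the loss lies beyond u or
        makes the loss infinite. The loss thus grows at least like u \<rho>, faster than weak
        duality at l allows for a finite G(l).\<close>
      have "ereal ((u - l) * \<rho> + m) \<le> ?G l" if \<rho>: "0 < \<rho>" for \<rho>
      proof -
        obtain k where k: "0 \<le> k" "robust_loss M f c \<rho> = ereal (k * \<rho>) + ?H k"
          using attained[OF \<rho>] by blast
        have "ereal (u * \<rho> + m) \<le> ereal (k * \<rho>) + ?H k"
        proof (cases "k \<le> u")
          case True
          then have "?H k = \<infinity>" using sup_expectation_antimono[OF k(1) True] False by auto
          then show ?thesis by simp
        next
          case False
          then have "u * \<rho> \<le> k * \<rho>" using \<rho> by simp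
          then show ?thesis using m[of k] by (cases "?H k") auto
        qed
        also have "\<dots> \<le> ereal (l * \<rho>) + ?G l"
          using robust_loss_le_plan_sup[of l \<rho>] l \<rho> k(2) by simp
        finally show ?thesis by (cases "?G l") (auto simp: algebra_simps)
      qed
      note bound = this
      have "?G l = \<infinity>"
      proof (cases "?G l")
        case (real g)
        \<comment> \<open>Chosen so that (u - l) ?r + m exceeds g by at least 1.\<close>
        let ?r = "(\<bar>g - m\<bar> + 1) / (u - l)"
        have "(u - l) * ?r = \<bar>g - m\<bar> + 1" "0 < ?r" using u by auto
        with bound[of ?r] real show ?thesis by simp
      qed (use bound[of 1] in auto)
      then show ?thesis by simp
    next
      case True
      define I where "I = {y. 0 \<le> y \<and> ?H y < \<infinity>}"
      define h where "h y = real_of_ereal (?H y)" for y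
      have H: "?H y = ereal (h y)" if "y \<in> I" for y
        using that m[of y] by (cases "?H y") (auto simp: I_def h_def)
      have comb: "(1 - t) * y + t * z \<in> I \<and> h ((1 - t) * y + t * z) \<le> (1 - t) * h y + t * h z"
        if t: "0 < t" "t < 1" and yz: "y \<in> I" "z \<in> I" for t y z
      proof -
        have 0: "0 \<le> y" "0 \<le> z" using yz by (auto simp: I_def)
        have *: "?H ((1 - t) * y + t * z) \<le> ereal ((1 - t) * h y + t * h z)"
          using sup_expectation_convex[OF t 0 meas[OF 0(1)] meas[OF 0(2)]] yz by (simp add: H)
        then have "(1 - t) * y + t * z \<in> I"
          using 0 t by (auto simp: I_def intro: order.strict_trans1)
        with * show ?thesis by (simp add: H)
      qed
      have convex: "convex I"
        unfolding convex_alt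
      proof (intro ballI allI impI)
        fix y z t :: real assume "y \<in> I" "z \<in> I" "0 \<le> t \<and> t \<le> 1"
        then show "(1 - t) *\<^sub>R y + t *\<^sub>R z \<in> I"
          using comb[of t y z] by (cases "t = 0"; cases "t = 1") auto
      qed
      have "convex_on I h"
        by (rule convex_onI[OF _ convex]) (use comb in auto)
      moreover have sub: "{u..} \<subseteq> I"
      proof
        fix y assume "y \<in> {u..}"
        with u sup_expectation_antimono[of u y] have "0 \<le> y" "?H y \<le> ?H u" by auto
        with True show "y \<in> I" unfolding I_def by (blast intro: order.strict_trans1)
      qed
      then have "x \<in> interior I"
        using u by (intro interiorI[of "{u<..}"] order_trans[OF _ sub]) auto
      ultimately obtain g where g: "\<And>y. y \<in> I \<Longrightarrow> h x + g * (y - x) \<le> h y"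
        by (rule convex_on_subgradient) blast
      have xI: "x \<in> I" "x + 1 \<in> I" using sub u by auto
      then have "h (x + 1) \<le> h x"
        using sup_expectation_antimono[of x "x + 1"] l x by (simp add: H)
      with g[OF xI(2)] have g0: "g \<le> 0" by simp
      have "?H x \<le> ?G x"
      proof (rule ereal_le_epsilon2)
        fix e :: real assume e: "0 < e"
        define d where "d = e / x"
        have d: "0 < d" "x * d = e" using e l x by (auto simp: d_def)
        \<comment> \<open>The budget -g may be 0, while \<open>attained\<close> speaks of positive
          budgets; raising it by d costs x d = e at the multiplier x.\<close>
        define \<rho> where "\<rho> = d - g"
        have \<rho>: "0 < \<rho>" using d g0 by (simp add: \<rho>_def)
        obtain k where k: "0 \<le> k" "robust_loss M f c \<rho> = ereal (k * \<rho>) + ?H k"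
          using attained[OF \<rho>] by blast
        \<comment> \<open>The supporting line cancels the term -g k of k \<rho>, leaving a bound
          independent of k up to the nonnegative k d.\<close>
        have "ereal (h x - g * x) \<le> ereal (k * \<rho>) + ?H k"
        proof (cases "k \<in> I")
          case True
          have "0 \<le> k * d" using k d by simp
          then have "h x - g * x \<le> k * \<rho> + h k"
            using g[OF True] by (simp add: \<rho>_def algebra_simps)
          then show ?thesis by (simp add: H[OF True])
        next
          case False
          with k(1) have "?H k = \<infinity>" by (simp add: I_def)
          then show ?thesis by simp
        qed
        also have "\<dots> \<le> ereal (x * \<rho>) + ?G x"
          using robust_loss_le_plan_sup[of x \<rho>] l x \<rho> k(2) by simp
        also have "x * \<rho> = e - g * x" using d by (simp add: \<rho>_def algebra_simps)
        finally show "?H x \<le> ?G x + ereal e"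
          by (cases "?G x") (auto simp: H[OF xI(1)])
      qed
      also have "\<dots> \<le> ?G l" using l x by (intro plan_sup_antimono) auto
      finally show ?thesis .
    qed
  qed
  then have "(SUP n. ?H (l + 1 / Suc n)) \<le> ?G l"
    by (intro SUP_least) simp
  moreover have "?H l = (SUP n. ?H (l + 1 / Suc n))"
    using l by (intro SUP_sup_expectation meas) auto
  ultimately show ?thesis by simp
qed

text \<open>The dual minimum also ranges over the multiplier 0, where (IP) is not assumed. H(0) is
  the supremum of H along positive multipliers, where H = G, and G there is at most G(0).\<close>

lemma interchangeable_zero:
  assumes "\<And>l. 0 < l \<Longrightarrow> interchangeable M (penalized f c l)"
  shows "interchangeable M (penalized f c 0)"
proof -
  have meas: "sup_pen (0 + 1 / Suc n) \<in> borel_measurable (completion M)" for n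
    using assms[of "0 + 1 / Suc n"] by (simp add: interchangeable_def expectation_exists_sup_pen_iff)
  have eq: "sup_expectation (0 + 1 / Suc n) = plan_sup M (penalized f c (0 + 1 / Suc n))" for n
    using assms[of "0 + 1 / Suc n"] by (simp add: interchangeable_def)
  have meas0: "sup_pen 0 \<in> borel_measurable (completion M)"
    by (rule sup_pen_measurable_limit[OF _ meas]) simp
  have "sup_expectation 0 = (SUP n. plan_sup M (penalized f c (0 + 1 / Suc n)))"
    unfolding eq[symmetric] by (rule SUP_sup_expectation[OF _ meas]) simp
  also have "\<dots> \<le> plan_sup M (penalized f c 0)"
    by (intro SUP_least plan_sup_antimono) auto
  finally show ?thesis
    using plan_sup_le_sup_expectation[OF meas0] meas0
    by (auto simp: interchangeable_def expectation_exists_sup_pen_iff)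
qed

lemma interchangeable_iff_minimum:
  "(\<forall>\<rho>>0. (\<forall>l\<ge>0. expectation_exists (completion M) (sup_pen l)) \<and>
      is_minimum (robust_loss M f c \<rho>) {ereal (l * \<rho>) + sup_expectation l | l. 0 \<le> l})
    \<longleftrightarrow> (\<forall>l>0. interchangeable M (penalized f c l))" (is "?lhs \<longleftrightarrow> ?rhs")
proof (intro iffI allI impI conjI)
  fix l :: real assume lhs: ?lhs and l: "0 < l"
  \<comment> \<open>Measurability does not depend on the budget, so it is read off at \<rho> =
    1.\<close>
  have exists: "expectation_exists (completion M) (sup_pen k)" if "0 \<le> k" for k
    using lhs[rule_format, OF zero_less_one, THEN conjunct1] that by blast
  have meas: "sup_pen k \<in> borel_measurable (completion M)" if "0 \<le> k" for k
    using exists[OF that] by (simp only: expectation_exists_sup_pen_iff)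
  have attained: "\<exists>k\<ge>0. robust_loss M f c \<rho> = ereal (k * \<rho>) + sup_expectation k" if "0 < \<rho>" for \<rho>
  proof -
    have "robust_loss M f c \<rho> \<in> {ereal (k * \<rho>) + sup_expectation k | k. 0 \<le> k}"
      using lhs[rule_format, OF that, THEN conjunct2] by (simp only: is_minimum_def)
    then show ?thesis by blast
  qed
  have "sup_expectation l = plan_sup M (penalized f c l)"
  proof (rule antisym)
    show "sup_expectation l \<le> plan_sup M (penalized f c l)"
      by (rule sup_expectation_le_plan_sup[OF meas attained l])
    show "plan_sup M (penalized f c l) \<le> sup_expectation l"
      by (rule plan_sup_le_sup_expectation[OF meas]) (use l in simp)
  qed
  with exists[of l] l show "interchangeable M (penalized f c l)"
    by (simp only: interchangeable_def less_imp_le)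
next
  fix \<rho> :: real assume rhs: ?rhs and \<rho>: "0 < \<rho>"
  have ip: "interchangeable M (penalized f c l)" if "0 \<le> l" for l
  proof (cases "l = 0")
    case True
    have "interchangeable M (penalized f c 0)"
      by (rule interchangeable_zero) (rule rhs[rule_format])
    with True show ?thesis by (simp only:)
  next
    case False
    with that show ?thesis by (intro rhs[rule_format]) simp
  qed
  show "expectation_exists (completion M) (sup_pen l)" if "0 \<le> l" for l
    using ip[OF that] by (simp only: interchangeable_def)
  have "sup_expectation l = plan_sup M (penalized f c l)" if "0 \<le> l" for l
    using ip[OF that] by (simp only: interchangeable_def)
  then have "{ereal (l * \<rho>) + sup_expectation l | l. 0 \<le> l} =
      {ereal (l * \<rho>) + plan_sup M (penalized f c l) | l. 0 \<le> l}"
    by (intro Collect_cong ex_cong1 rev_conj_cong refl) (simp only:)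
  then show "is_minimum (robust_loss M f c \<rho>) {ereal (l * \<rho>) + sup_expectation l | l. 0 \<le> l}"
    using robust_loss_is_minimum[OF \<rho>] by (simp only:)
qed

end

theorem theorem1:
  fixes M :: "'a measure" and f :: "'a \<Rightarrow> real" and c :: "'a \<Rightarrow> 'a \<Rightarrow> ennreal"
  assumes "prob_space M"
    and "f \<in> borel_measurable M"
    and "expectation_exists M f" and "ereal_expectation M f > -\<infinity>"
    and "(\<lambda>(xh, x). c xh x) \<in> borel_measurable (M \<Otimes>\<^sub>M M)"
    and "\<And>x. x \<in> space M \<Longrightarrow> c x x = 0"
  shows
    "(\<forall>l>0.
        Sup {ereal_expectation P f - scale_cost l (transport_cost M c P) | P.
               P \<in> finite_cost_measures M c \<and> expectation_exists P f}
          = legendre (\<lambda>\<rho>. - robust_loss M f c \<rho>) (- l) \<and>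
        legendre (\<lambda>\<rho>. - robust_loss M f c \<rho>) (- l) = plan_sup M (penalized f c l)) \<and>
     (\<forall>\<rho>>0.
        is_minimum (robust_loss M f c \<rho>)
          {ereal (l * \<rho>) + plan_sup M (penalized f c l) | l. 0 \<le> l}) \<and>
     (\<forall>l>0.
        (expectation_exists (completion M) (sup_over M (penalized f c l)) \<and>
         legendre (\<lambda>\<rho>. - robust_loss M f c \<rho>) (- l)
           = ereal_expectation (completion M) (sup_over M (penalized f c l)))
        \<longleftrightarrow> interchangeable M (penalized f c l)) \<and>
     ((\<forall>\<rho>>0.
        (\<forall>l\<ge>0. expectation_exists (completion M) (sup_over M (penalized f c l))) \<and>
        is_minimum (robust_loss M f c \<rho>)
          {ereal (l * \<rho>) + ereal_expectation (completion M) (sup_over M (penalized f c l)) | l. 0 \<le> l})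
      \<longleftrightarrow> (\<forall>l>0. interchangeable M (penalized f c l)))"
proof -
  have "lower_integrable M f"
    using assms(3,4) by (simp only: lower_integrable_iff)
  with assms(1,5,6) interpret transport_problem M f c
    by (intro transport_problem.intro)
  have part1: "legendre (\<lambda>\<rho>. - robust_loss M f c \<rho>) (- l) = plan_sup M (penalized f c l)"
      "Sup {ereal_expectation P f - scale_cost l (transport_cost M c P) | P.
        P \<in> finite_cost_measures M c \<and> expectation_exists P f}
        = legendre (\<lambda>\<rho>. - robust_loss M f c \<rho>) (- l)" if "0 < l" for l
    by (simp_all only: legendre_robust_loss[OF less_imp_le[OF that]] penalty_sup_eq_plan_sup[OF less_imp_le[OF that]])
  have part3: "(expectation_exists (completion M) (sup_pen l) \<and>
      legendre (\<lambda>\<rho>. - robust_loss M f c \<rho>) (- l) = sup_expectation l)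
      \<longleftrightarrow> interchangeable M (penalized f c l)" if "0 < l" for l
    unfolding interchangeable_def part1(1)[OF that] by (rule conj_cong[OF refl eq_commute])
  show ?thesis
    by (rule conjI[OF _ conjI[OF _ conjI[OF _ interchangeable_iff_minimum]]])
      (intro allI impI conjI part1 part3 robust_loss_is_minimum; assumption)+
qed

end
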